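(* Let $(\Gamma,G)\in\mathcal{OG}(4)$ with vertex set $X$, and let $N$ be a normal subgroup of $G$. Then $G$ induces a permutation group $\overline{G}$ on the set of $N$-orbits in $X$, and either (i) $(\Gamma_N,\overline{G})\in\mathcal{OG}(4)$, $\Gamma$ is a $G$-normal cover of $\Gamma_N$, $N$ is semiregular on $X$, and $\overline{G}=G/N$ (that is, the kernel of the $G$-action on the set of $N$-orbits is exactly $N$); or (ii) $(\Gamma_N,\overline{G})$ is one of the following: (1) $\Gamma_N=K_1$, $\overline{G}=1$, and $N$ is transitive on $X$; (2) $\Gamma_N=K_2$, $\overline{G}=Z_2$, $\Gamma$ is bipartite, and the $N$-orbits form the bipartition; (3) $\Gamma_N=C_r$ and $\overline{G}=D_{2r}$ for some $r\geq 3$, with $\overline{G}$ arc-transitive on $\Gamma_N$, and $\Gamma$ is a $G$-normal $2$-multicover of $\Gamma_N$; (4) $\Gamma_N=C_r$ and $\overline{G}=Z_r$ for some $r\geq 3$, with $\Gamma_N$ being $\overline{G}$-oriented, and $\Gamma$ is a $G$-normal $2$-multicover of $\Gamma_N$.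
   Context: All graphs are finite, simple and undirected. For even $m\ge 2$, $\mathcal{OG}(m)$ is the set of pairs $(\Gamma,G)$ where $\Gamma$ is a connected graph of valency $m$ with vertex set $X$, and $G\leq\mathrm{Aut}(\Gamma)$ is transitive on $X$ and on edges, and $\Gamma$ is $G$-oriented: there is a $G$-orbit $\Delta\subset X\times X$, disjoint from $\Delta^*=\{(y,x)\mid (x,y)\in\Delta\}$, such that the edges of $\Gamma$ are exactly the pairs $\{x,y\}$ with $(x,y)\in\Delta$ or $(y,x)\in\Delta$ (the edge is then oriented $x\to y$ when $(x,y)\in\Delta$). For $N\trianglelefteq G$, the $G$-normal quotient $\Gamma_N$ is the graph whose vertices are the $N$-orbits in $X$, with distinct $N$-orbits $B,C$ adjacent if and only if there is an edge $\{x,y\}$ of $\Gamma$ with $x\in B$, $y\in C$. The group $\overline{G}$ is the permutation group induced by $G$ on the set of $N$-orbits. $\Gamma$ is a $G$-normal $\ell$-multicover of $\Gamma_N$ if, for each edge $\{B,C\}$ of $\Gamma_N$, each vertex of $B$ is joined by an edge of $\Gamma$ to exactly $\ell$ vertices of $C$; a $G$-normal cover is the case $\ell=1$. A permutation group is semiregular if only the identity fixes a point. $K_r$, $C_r$ are the complete graph and the cycle on $r$ vertices; $Z_r$ is the cyclic group of order $r$ and $D_{2r}$ the dihedral group of order $2r$. *)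

theory Defs
  imports
    "Graph_Theory.Graph_Theory"
    "HOL-Algebra.Group_Action"
    "HOL-Algebra.Elementary_Groups"
begin

text \<open>
  A finite simple undirected graph is a \<open>pair_graph\<close>: a finite, loop-free, symmetric digraph whose
  arcs are ordered pairs of vertices, so an edge \<open>{x, y}\<close> is represented by both arcs \<open>(x, y)\<close> and
  \<open>(y, x)\<close>. Connected graphs are nonempty (\<open>connected\<close> of \<open>Graph_Theory\<close> requires this).
  A permutation group on \<open>X\<close> is a subgroup of \<open>BijGroup X\<close>, given by its set of elements.
\<close>

definition perm_group :: "'a set \<Rightarrow> ('a \<Rightarrow> 'a) set \<Rightarrow> ('a \<Rightarrow> 'a) monoid" where
  "perm_group X G = (BijGroup X)\<lparr>carrier := G\<rparr>"

definition edges :: "'a pair_pre_digraph \<Rightarrow> 'a set set" where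
  "edges \<Gamma> = {{x, y} | x y. (x, y) \<in> parcs \<Gamma>}"

definition graph_Aut :: "'a pair_pre_digraph \<Rightarrow> ('a \<Rightarrow> 'a) set" where
  "graph_Aut \<Gamma> = {g \<in> Bij (pverts \<Gamma>).
     \<forall>x \<in> pverts \<Gamma>. \<forall>y \<in> pverts \<Gamma>. (g x, g y) \<in> parcs \<Gamma> \<longleftrightarrow> (x, y) \<in> parcs \<Gamma>}"

text \<open>
  The action of permutations on a family of subsets; the restriction to the family makes the
  result an element of \<open>BijGroup \<Omega>\<close> whenever the family is invariant.
\<close>

definition set_action :: "'a set set \<Rightarrow> ('a \<Rightarrow> 'a) \<Rightarrow> ('a set \<Rightarrow> 'a set)" where
  "set_action \<Omega> g = (\<lambda>B \<in> \<Omega>. g ` B)"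

definition vertex_transitive :: "'a pair_pre_digraph \<Rightarrow> ('a \<Rightarrow> 'a) set \<Rightarrow> bool" where
  "vertex_transitive \<Gamma> G \<longleftrightarrow>
     transitive_action (perm_group (pverts \<Gamma>) G) (pverts \<Gamma>) (\<lambda>g. g)"

definition edge_transitive :: "'a pair_pre_digraph \<Rightarrow> ('a \<Rightarrow> 'a) set \<Rightarrow> bool" where
  "edge_transitive \<Gamma> G \<longleftrightarrow>
     transitive_action (perm_group (pverts \<Gamma>) G) (edges \<Gamma>) (set_action (edges \<Gamma>))"

definition arc_transitive :: "'a pair_pre_digraph \<Rightarrow> ('a \<Rightarrow> 'a) set \<Rightarrow> bool" where
  "arc_transitive \<Gamma> G \<longleftrightarrow>
     transitive_action (perm_group (pverts \<Gamma>) G) (parcs \<Gamma>)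
       (\<lambda>g. restrict (map_prod g g) (parcs \<Gamma>))"

definition oriented :: "'a pair_pre_digraph \<Rightarrow> ('a \<Rightarrow> 'a) set \<Rightarrow> bool" where
  "oriented \<Gamma> G \<longleftrightarrow>
     (\<exists>\<Delta> \<in> orbits (perm_group (pverts \<Gamma>) G) (pverts \<Gamma> \<times> pverts \<Gamma>) (\<lambda>g. map_prod g g).
        \<Delta> \<inter> \<Delta>\<inverse> = {} \<and> parcs \<Gamma> = \<Delta> \<union> \<Delta>\<inverse>)"

definition OG :: "nat \<Rightarrow> ('a pair_pre_digraph \<times> ('a \<Rightarrow> 'a) set) set" where
  "OG m = {(\<Gamma>, G).
     pair_graph \<Gamma> \<and> connected (with_proj \<Gamma>) \<and>
     (\<forall>x \<in> pverts \<Gamma>. out_degree (with_proj \<Gamma>) x = m) \<and>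
     subgroup G (BijGroup (pverts \<Gamma>)) \<and> G \<subseteq> graph_Aut \<Gamma> \<and>
     vertex_transitive \<Gamma> G \<and> edge_transitive \<Gamma> G \<and> oriented \<Gamma> G}"

definition vertex_orbits :: "'a pair_pre_digraph \<Rightarrow> ('a \<Rightarrow> 'a) set \<Rightarrow> 'a set set" where
  "vertex_orbits \<Gamma> N = orbits (perm_group (pverts \<Gamma>) N) (pverts \<Gamma>) (\<lambda>g. g)"

definition normal_quotient :: "'a pair_pre_digraph \<Rightarrow> ('a \<Rightarrow> 'a) set \<Rightarrow> 'a set pair_pre_digraph" where
  "normal_quotient \<Gamma> N =
     \<lparr>pverts = vertex_orbits \<Gamma> N,
      parcs = {(B, C). B \<in> vertex_orbits \<Gamma> N \<and> C \<in> vertex_orbits \<Gamma> N \<and> B \<noteq> C \<and>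
                       (\<exists>x \<in> B. \<exists>y \<in> C. (x, y) \<in> parcs \<Gamma>)}\<rparr>"

definition induced_group ::
  "'a pair_pre_digraph \<Rightarrow> ('a \<Rightarrow> 'a) set \<Rightarrow> ('a \<Rightarrow> 'a) set \<Rightarrow> ('a set \<Rightarrow> 'a set) set" where
  "induced_group \<Gamma> G N = set_action (vertex_orbits \<Gamma> N) ` G"

definition normal_multicover :: "nat \<Rightarrow> 'a pair_pre_digraph \<Rightarrow> ('a \<Rightarrow> 'a) set \<Rightarrow> bool" where
  "normal_multicover l \<Gamma> N \<longleftrightarrow>
     (\<forall>(B, C) \<in> parcs (normal_quotient \<Gamma> N). \<forall>x \<in> B. card {y \<in> C. (x, y) \<in> parcs \<Gamma>} = l)"

abbreviation normal_cover :: "'a pair_pre_digraph \<Rightarrow> ('a \<Rightarrow> 'a) set \<Rightarrow> bool" where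
  "normal_cover \<equiv> normal_multicover 1"

definition semiregular :: "'a set \<Rightarrow> ('a \<Rightarrow> 'a) set \<Rightarrow> bool" where
  "semiregular X N \<longleftrightarrow> (\<forall>g \<in> N. (\<exists>x \<in> X. g x = x) \<longrightarrow> g = \<one>\<^bsub>BijGroup X\<^esub>)"

definition is_bipartition :: "'a pair_pre_digraph \<Rightarrow> 'a set set \<Rightarrow> bool" where
  "is_bipartition \<Gamma> P \<longleftrightarrow>
     (\<exists>U V. P = {U, V} \<and> U \<inter> V = {} \<and> U \<union> V = pverts \<Gamma> \<and> parcs \<Gamma> \<subseteq> U \<times> V \<union> V \<times> U)"

definition bipartite :: "'a pair_pre_digraph \<Rightarrow> bool" where
  "bipartite \<Gamma> \<longleftrightarrow> (\<exists>P. is_bipartition \<Gamma> P)"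

text \<open>This is a cycle (a simple graph of valency 2) only for \<open>r \<ge> 3\<close>.\<close>

definition cycle_graph :: "nat \<Rightarrow> nat pair_pre_digraph" where
  "cycle_graph r =
     \<lparr>pverts = {..<r},
      parcs = {(i, j). i < r \<and> j < r \<and> (j = Suc i mod r \<or> i = Suc j mod r)}\<rparr>"

text \<open>
  The dihedral group of order \<open>2 r\<close> as the semidirect product of the cyclic group of order \<open>r\<close>
  by a group of order 2 acting by inversion; the pair \<open>(a, s)\<close> stands for the rotation
  by \<open>a\<close> preceded, if \<open>s\<close> holds, by a fixed reflection.
\<close>

definition dihedral_group :: "nat \<Rightarrow> (int \<times> bool) monoid" where
  "dihedral_group r =
     \<lparr>carrier = carrier (integer_mod_group r) \<times> UNIV,
      mult = (\<lambda>(a, s) (b, t). ((if s then a - b else a + b) mod int r, s \<noteq> t)),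
      one = (0, False)\<rparr>"

end

theory Submission
  imports Defs
begin

text \<open>
  Write \<open>\<Delta>\<close> for the orbit of arcs that orients \<open>\<Gamma>\<close>; every vertex has out-valency and in-valency 2 in it.
  The image of \<open>\<Delta>\<close> in the set of \<open>N\<close>-orbits is again a single orbit \<open>\<Delta>\<^sub>N\<close> of the induced group on pairs, so
  it is reflexive (and then connectivity leaves only one \<open>N\<close>-orbit) or irreflexive, and symmetric or
  asymmetric. Since \<open>G\<close> permutes transitively the pairs (vertex \<open>x\<close>, \<open>N\<close>-orbit joined by \<open>\<Delta>\<^sub>N\<close> to the
  \<open>N\<close>-orbit of \<open>x\<close>), the out-valency of \<open>\<Delta>\<^sub>N\<close> divides 2. Out-valency 1 makes \<open>\<Delta>\<^sub>N\<close> a directed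
  cycle with induced group \<open>Z\<^sub>r\<close>; out-valency 2 gives, in the symmetric case, an undirected cycle on
  whose arcs the induced group is transitive, hence dihedral, and in the asymmetric case a normal cover.
\<close>

section \<open>Permutation groups and connected orbitals\<close>

text \<open>The image of \<open>D\<close> among the blocks may acquire loops or coincide with its
  converse although \<open>D\<close> does neither. The working notion is therefore an arbitrary
  connected orbital, with no condition on loops or reversed arcs. This class is closed under
  reversing all arcs and under passing to the blocks of a normal subgroup, so each fact is proved
  once, for out-neighbours, and serves also for in-neighbours and for the quotient. Connectivity
  enters through a closure principle: a nonempty set of points closed under neighbours in both
  directions is everything. On cycles it shows that one well chosen element \<open>h\<close> moves
  every point one step, so that its powers number the points by the integers modulo \<open>r\<close>
  and the group becomes a group of maps \<open>c + s * i\<close> with \<open>s = 1\<close> or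
  \<open>s = - 1\<close>. A directed cycle of length two is its own converse; it is the case in
  which valency one yields \<open>K_2\<close>. The number 2 of the multicovers has two sources: two
  arcs of the same direction over a directed cycle, one arc each way over a symmetric one.\<close>

lemma normal_perm_group_subset:
  assumes "N \<lhd> perm_group X G" shows "N \<subseteq> G"
  using normal_imp_subgroup[OF assms] by (fastforce simp: perm_group_def dest: subgroup.subset)

locale permutation_group =
  fixes X :: "'a set" and H :: "('a \<Rightarrow> 'a) set"
  assumes subgroup_BijGroup: "subgroup H (BijGroup X)"
begin

lemma in_Bij: "g \<in> H \<Longrightarrow> g \<in> Bij X"
  using subgroup.subset[OF subgroup_BijGroup] by (auto simp: BijGroup_def)

lemma bij: "g \<in> H \<Longrightarrow> bij_betw g X X"
  using in_Bij by (auto simp: Bij_def)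

lemma closed [simp]: "g \<in> H \<Longrightarrow> x \<in> X \<Longrightarrow> g x \<in> X"
  using bij bij_betwE by blast

lemma image [simp]: "g \<in> H \<Longrightarrow> g ` X = X"
  using bij bij_betw_imp_surj_on by blast

lemma inj: "g \<in> H \<Longrightarrow> inj_on g X"
  using bij bij_betw_imp_inj_on by blast

lemma eq_iff [simp]: "g \<in> H \<Longrightarrow> x \<in> X \<Longrightarrow> y \<in> X \<Longrightarrow> g x = g y \<longleftrightarrow> x = y"
  using inj by (auto dest: inj_onD)

lemma eqI: "g \<in> H \<Longrightarrow> h \<in> H \<Longrightarrow> (\<And>x. x \<in> X \<Longrightarrow> g x = h x) \<Longrightarrow> g = h"
  using in_Bij by (meson Bij_imp_extensional extensionalityI)

lemma id_mem: "(\<lambda>x\<in>X. x) \<in> H"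
  using subgroup.one_closed[OF subgroup_BijGroup] by (simp add: BijGroup_def)

lemma compose_mem: "g \<in> H \<Longrightarrow> h \<in> H \<Longrightarrow> compose X g h \<in> H"
  using subgroup.m_closed[OF subgroup_BijGroup, of g h] in_Bij by (simp add: BijGroup_def)

lemma inverse_mem: "g \<in> H \<Longrightarrow> restrict (inv_into X g) X \<in> H"
  using subgroup.m_inv_closed[OF subgroup_BijGroup, of g] in_Bij by (simp add: inv_BijGroup)

lemma ex_inverse:
  assumes "g \<in> H"
  shows "\<exists>h\<in>H. \<forall>x\<in>X. h (g x) = x \<and> g (h x) = x"
proof
  show "restrict (inv_into X g) X \<in> H" by (rule inverse_mem[OF assms])
  show "\<forall>x\<in>X. restrict (inv_into X g) X (g x) = x \<and> g (restrict (inv_into X g) X x) = x"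
    using assms inv_into_f_f[OF inj[OF assms]] f_inv_into_f[of _ g X] by simp
qed

lemma carrier_perm_group [simp]: "carrier (perm_group X H) = H"
  by (simp add: perm_group_def)

lemma mult_perm_group [simp]:
  "g \<in> H \<Longrightarrow> h \<in> H \<Longrightarrow> g \<otimes>\<^bsub>perm_group X H\<^esub> h = compose X g h"
  using in_Bij by (simp add: perm_group_def BijGroup_def)

lemma group_perm_group: "group (perm_group X H)"
  unfolding perm_group_def
  by (rule subgroup.subgroup_is_group[OF subgroup_BijGroup group_BijGroup])

text \<open>\<open>Bij E\<close> contains only extensional maps, so the composition law has to be
  checked on points of \<open>E\<close> only.\<close>

lemma group_action_perm_group:
  assumes "\<And>g. g \<in> H \<Longrightarrow> \<phi> g \<in> Bij E"
    and "\<And>g h x. g \<in> H \<Longrightarrow> h \<in> H \<Longrightarrow> x \<in> E \<Longrightarrow> \<phi> (compose X g h) x = \<phi> g (\<phi> h x)"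
  shows "group_action (perm_group X H) E \<phi>"
proof -
  have "\<phi> (compose X g h) = compose E (\<phi> g) (\<phi> h)" if gh: "g \<in> H" "h \<in> H" for g h
  proof (rule extensionalityI)
    show "\<phi> (compose X g h) \<in> extensional E"
      using assms(1) compose_mem[OF gh] Bij_imp_extensional by blast
  qed (use assms(2)[OF gh] in \<open>auto simp: compose_eq\<close>)
  then have "\<phi> \<in> hom (perm_group X H) (BijGroup E)"
    by (auto simp: hom_def assms(1)) (auto simp: BijGroup_def assms(1))
  then show ?thesis
    by (simp add: group_action_def group_hom_def group_hom_axioms_def
        group_perm_group group_BijGroup)
qed

lemma set_action_Bij:
  assumes "g \<in> H" "\<Omega> \<subseteq> Pow X" "(\<lambda>B. g ` B) ` \<Omega> = \<Omega>"
  shows "set_action \<Omega> g \<in> Bij \<Omega>"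
proof -
  have "inj_on (\<lambda>B. g ` B) \<Omega>"
    using inj_on_image_Pow[OF inj[OF assms(1)]] assms(2) by (rule inj_on_subset)
  then have "bij_betw (\<lambda>B. g ` B) \<Omega> \<Omega>"
    using assms(3) by (simp add: bij_betw_def)
  then show ?thesis
    using bij_betw_cong[of \<Omega> "set_action \<Omega> g" "\<lambda>B. g ` B" \<Omega>] by (simp add: Bij_def set_action_def)
qed

text \<open>Invariance is assumed in one direction; applied to the inverse of \<open>g\<close> in
  \<open>H\<close> it also shows that \<open>g\<close> maps the family onto itself.\<close>

lemma group_action_set_action:
  assumes "\<Omega> \<subseteq> Pow X" "\<And>g B. g \<in> H \<Longrightarrow> B \<in> \<Omega> \<Longrightarrow> g ` B \<in> \<Omega>"
  shows "group_action (perm_group X H) \<Omega> (set_action \<Omega>)"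
proof (rule group_action_perm_group)
  fix g assume g: "g \<in> H"
  obtain h where h: "h \<in> H" "\<And>x. x \<in> X \<Longrightarrow> h (g x) = x" "\<And>x. x \<in> X \<Longrightarrow> g (h x) = x"
    using ex_inverse[OF g] by blast
  have "B \<in> (\<lambda>B. g ` B) ` \<Omega>" if "B \<in> \<Omega>" for B
  proof
    have "B \<subseteq> X" using assms(1) that by blast
    then have "(\<lambda>x. g (h x)) ` B = (\<lambda>x. x) ` B" by (intro image_cong) (auto simp: h(3))
    then show "B = g ` (h ` B)" by (simp add: image_image)
    show "h ` B \<in> \<Omega>" by (rule assms(2)[OF h(1) that])
  qed
  then have "(\<lambda>B. g ` B) ` \<Omega> = \<Omega>" using assms(2)[OF g] by blast
  then show "set_action \<Omega> g \<in> Bij \<Omega>" by (rule set_action_Bij[OF g assms(1)])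
next
  fix g h B assume gh: "g \<in> H" "h \<in> H" and B: "B \<in> \<Omega>"
  have "compose X g h ` B = (\<lambda>x. g (h x)) ` B"
    using B assms(1) by (intro image_cong) (auto simp: compose_def)
  then have "compose X g h ` B = g ` h ` B" by (simp add: image_image)
  then show "set_action \<Omega> (compose X g h) B = set_action \<Omega> g (set_action \<Omega> h B)"
    using B assms(2)[OF gh(2) B] by (simp add: set_action_def)
qed

lemma group_action_apply: "group_action (perm_group X H) X (\<lambda>g. g)"
  by (rule group_action_perm_group) (auto simp: in_Bij compose_def)

lemma group_action_pairs:
  assumes "R \<subseteq> X \<times> X" "\<And>g x y. g \<in> H \<Longrightarrow> (x, y) \<in> R \<Longrightarrow> (g x, g y) \<in> R"
  shows "group_action (perm_group X H) R (\<lambda>g. restrict (map_prod g g) R)"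
proof (rule group_action_perm_group)
  fix g assume g: "g \<in> H"
  obtain h where h: "h \<in> H" "\<And>x. x \<in> X \<Longrightarrow> h (g x) = x" "\<And>x. x \<in> X \<Longrightarrow> g (h x) = x"
    using ex_inverse[OF g] by blast
  have "inj_on (map_prod g g) (X \<times> X)" using inj[OF g] by (simp add: map_prod_inj_on)
  then have "inj_on (map_prod g g) R" using assms(1) by (rule inj_on_subset)
  moreover have "map_prod g g ` R = R"
  proof
    show "map_prod g g ` R \<subseteq> R" using assms(2)[OF g] by auto
    show "R \<subseteq> map_prod g g ` R"
    proof
      fix p assume p: "p \<in> R"
      obtain x y where xy: "p = (x, y)" by fastforce
      have "p = map_prod g g (h x, h y)" using p xy assms(1) h(3) by auto
      then show "p \<in> map_prod g g ` R" using assms(2)[OF h(1), of x y] p xy by (metis imageI)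
    qed
  qed
  ultimately have "bij_betw (map_prod g g) R R" by (simp add: bij_betw_def)
  then show "restrict (map_prod g g) R \<in> Bij R"
    by (simp add: Bij_def)
next
  fix g h p assume gh: "g \<in> H" "h \<in> H" and p: "p \<in> R"
  obtain x y where xy: "p = (x, y)" "x \<in> X" "y \<in> X" using p assms(1) by blast
  have "(h x, h y) \<in> R" using assms(2) gh p xy by blast
  then show "restrict (map_prod (compose X g h) (compose X g h)) R p
    = restrict (map_prod g g) R (restrict (map_prod h h) R p)"
    using p xy by (simp add: compose_def)
qed

lemma subgroup_image:
  assumes "group_action (perm_group X H) E \<phi>"
  shows "subgroup (\<phi> ` H) (BijGroup E)"
proof -
  interpret group_hom "perm_group X H" "BijGroup E" \<phi>
    using assms by (rule group_action.group_hom)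
  show ?thesis using img_is_subgroup by simp
qed

end

section \<open>Orbits on ordered pairs with connected underlying graph\<close>

locale transitive_permutation_group = permutation_group +
  assumes finite_domain: "finite X"
    and nonempty: "X \<noteq> {}"
    and transitive: "x \<in> X \<Longrightarrow> y \<in> X \<Longrightarrow> \<exists>g\<in>H. g x = y"

text \<open>\<open>orbital_closed\<close> and \<open>orbital_transitive\<close> together make
  \<open>D\<close> a single orbit on pairs without naming a base pair, a form that passes easily to
  images and converses.\<close>

locale connected_orbital = transitive_permutation_group +
  fixes D
  assumes orbital_subset: "D \<subseteq> X \<times> X"
    and orbital_nonempty: "D \<noteq> {}"
    and orbital_closed: "g \<in> H \<Longrightarrow> (x, y) \<in> D \<Longrightarrow> (g x, g y) \<in> D"
    and orbital_transitive: "(x, y) \<in> D \<Longrightarrow> (x', y') \<in> D \<Longrightarrow> \<exists>g\<in>H. g x = x' \<and> g y = y'"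
    and orbital_connected: "x \<in> X \<Longrightarrow> y \<in> X \<Longrightarrow> (x, y) \<in> (D \<union> D\<inverse>)\<^sup>*"
begin

text \<open>Induction along an undirected path from \<open>x\<close>; it spreads a local property
  from one point to all of them.\<close>

lemma connected_closure:
  assumes "x \<in> S" "x \<in> X" "S \<subseteq> X" "\<And>u v. u \<in> S \<Longrightarrow> (u, v) \<in> D \<union> D\<inverse> \<Longrightarrow> v \<in> S"
  shows "S = X"
proof -
  have "y \<in> S" if "y \<in> X" for y
    using orbital_connected[OF assms(2) that]
    by (induction rule: rtrancl_induct) (auto simp: assms(1) intro: assms(4))
  then show ?thesis using assms(3) by blast
qed

lemma finite_orbital: "finite D"
  using orbital_subset finite_domain by (meson finite_SigmaI finite_subset)

lemma orbital_iff:
  assumes "g \<in> H" "x \<in> X" "y \<in> X" shows "(g x, g y) \<in> D \<longleftrightarrow> (x, y) \<in> D"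
proof -
  obtain h where h: "h \<in> H" "\<And>x. x \<in> X \<Longrightarrow> h (g x) = x" "\<And>x. x \<in> X \<Longrightarrow> g (h x) = x"
    using ex_inverse[OF assms(1)] by blast
  show ?thesis
    using orbital_closed[OF assms(1), of x y] orbital_closed[OF h(1), of "g x" "g y"] h(2) assms(2,3)
    by auto
qed

lemma connected_orbital_converse: "connected_orbital X H (D\<inverse>)"
proof unfold_locales
  show "D\<inverse> \<subseteq> X \<times> X" using orbital_subset by blast
  show "D\<inverse> \<noteq> {}" using orbital_nonempty by auto
  show "(x, y) \<in> (D\<inverse> \<union> (D\<inverse>)\<inverse>)\<^sup>*" if "x \<in> X" "y \<in> X" for x y
    using orbital_connected[OF that] by (simp add: Un_commute)
  show "\<exists>g\<in>H. g x = x' \<and> g y = y'" if "(x, y) \<in> D\<inverse>" "(x', y') \<in> D\<inverse>" for x y x' y'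
    using orbital_transitive[of y x y' x'] that by auto
qed (use orbital_closed in auto)

lemma image_out: 
  assumes "g \<in> H" "x \<in> X" shows "D `` {g x} = g ` (D `` {x})"
proof -
  obtain h where h: "h \<in> H" "\<And>x. x \<in> X \<Longrightarrow> h (g x) = x" "\<And>x. x \<in> X \<Longrightarrow> g (h x) = x"
    using ex_inverse[OF assms(1)] by blast
  have "y \<in> g ` (D `` {x})" if "(g x, y) \<in> D" for y
  proof
    show "y = g (h y)" using that orbital_subset h(3) by auto
    show "h y \<in> D `` {x}" using orbital_closed[OF h(1) that] h(2)[OF assms(2)] by simp
  qed
  then show ?thesis using orbital_closed[OF assms(1)] by auto
qed

lemma out_subset: "D `` S \<subseteq> X"
  using orbital_subset by blast

lemma card_out_eq:
  assumes "x \<in> X" "y \<in> X" shows "card (D `` {x}) = card (D `` {y})"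
proof -
  obtain g where g: "g \<in> H" "g x = y" using transitive[OF assms] by blast
  have "inj_on g (D `` {x})" using inj[OF g(1)] out_subset by (rule inj_on_subset)
  then show ?thesis using image_out[OF g(1) assms(1)] g(2) by (simp add: card_image)
qed

text \<open>Arcs are counted by their tails, and by transitivity each point is the tail of equally
  many.\<close>

lemma card_orbital:
  assumes "x \<in> X" shows "card D = card X * card (D `` {x})"
proof -
  have "D = Sigma X (\<lambda>x. D `` {x})" using orbital_subset by auto
  then have "card D = card (Sigma X (\<lambda>x. D `` {x}))" by (rule arg_cong)
  also have "\<dots> = (\<Sum>y\<in>X. card (D `` {y}))"
    using finite_domain finite_subset[OF out_subset finite_domain] by (simp add: card_SigmaI)
  also have "\<dots> = (\<Sum>y\<in>X. card (D `` {x}))" using card_out_eq[OF _ assms] by (rule sum.cong[OF refl])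
  finally show ?thesis by simp
qed

lemma out_nonempty: "x \<in> X \<Longrightarrow> D `` {x} \<noteq> {}"
  using card_orbital[of x] finite_orbital orbital_nonempty by (auto simp: card_eq_0_iff)

lemma finite_out: "finite (D `` S)"
  using out_subset finite_domain by (rule finite_subset)

text \<open>\<open>D\<close> and its converse have equally many arcs; both numbers are
  \<open>card X\<close> times a valency, and \<open>card X\<close> is positive.\<close>

lemma card_in_eq_card_out:
  assumes "x \<in> X" shows "card (D\<inverse> `` {x}) = card (D `` {x})"
proof -
  interpret C: connected_orbital X H "D\<inverse>" by (rule connected_orbital_converse)
  have "card (D\<inverse>) = card D" by (simp add: card_inverse)
  then show ?thesis
    using C.card_orbital[OF assms] card_orbital[OF assms] finite_domain nonempty by simp
qed

text \<open>If one arc has its reverse in \<open>D\<close>, carrying that arc to an arbitrary arc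
  carries the reverse along.\<close>

lemma symmetric_or_asymmetric:
  obtains "D\<inverse> = D" | "D \<inter> D\<inverse> = {}"
proof (cases "D \<inter> D\<inverse> = {}")
  case False
  then obtain x y where xy: "(x, y) \<in> D" "(y, x) \<in> D" by auto
  have "(v, u) \<in> D" if "(u, v) \<in> D" for u v
    using orbital_transitive[OF xy(1) that] orbital_closed[OF _ xy(2)] by blast
  then have "D\<inverse> = D" by auto
  then show ?thesis using that by blast
qed (use that in blast)

text \<open>A loop can be carried only to loops, so one loop makes all arcs loops, and connectivity
  then leaves no second point.\<close>

lemma irreflexive_or_singleton:
  obtains "\<And>x. (x, x) \<notin> D" | x where "X = {x}"
proof (cases "\<exists>x. (x, x) \<in> D")
  case True
  then obtain x where x: "(x, x) \<in> D" by blast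
  have "v = u" if "(u, v) \<in> D" for u v
    using orbital_transitive[OF x that] by auto
  then have "{x} = X"
    using x orbital_subset by (intro connected_closure[of x]) auto
  then show ?thesis using that by metis
qed (use that in blast)

end

section \<open>Orbits of a normal subgroup\<close>

definition point_orbit :: "('a \<Rightarrow> 'a) set \<Rightarrow> 'a \<Rightarrow> 'a set" where
  "point_orbit N x = (\<lambda>n. n x) ` N"

lemma vertex_orbits_conv: "vertex_orbits \<Gamma> N = point_orbit N ` pverts \<Gamma>"
  by (auto simp: vertex_orbits_def orbits_def orbit_def perm_group_def point_orbit_def image_def)

context permutation_group
begin

lemma point_orbit_self: "x \<in> X \<Longrightarrow> x \<in> point_orbit H x"
  unfolding point_orbit_def by (rule image_eqI[OF _ id_mem]) simp

lemma point_orbit_subset: "x \<in> X \<Longrightarrow> point_orbit H x \<subseteq> X"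
  by (auto simp: point_orbit_def)

lemma point_orbit_subsetI:
  assumes x: "x \<in> X" and y: "y \<in> point_orbit H x" shows "point_orbit H y \<subseteq> point_orbit H x"
proof
  fix z assume "z \<in> point_orbit H y"
  then obtain g h where gh: "g \<in> H" "h \<in> H" "y = g x" "z = h (g x)"
    using y by (auto simp: point_orbit_def)
  then have "z = compose X h g x" using x by (simp add: compose_eq)
  then show "z \<in> point_orbit H x"
    using compose_mem[OF gh(2,1)] by (auto simp: point_orbit_def)
qed

lemma point_orbit_sym:
  assumes x: "x \<in> X" and y: "y \<in> point_orbit H x" shows "x \<in> point_orbit H y"
proof -
  obtain g where g: "g \<in> H" "y = g x" using y by (auto simp: point_orbit_def)
  obtain h where "h \<in> H" "h (g x) = x" using ex_inverse[OF g(1)] x by blast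
  then show ?thesis unfolding point_orbit_def g(2) by (intro image_eqI[of _ _ h]) simp_all
qed

lemma point_orbit_eq:
  assumes "x \<in> X" "y \<in> point_orbit H x" shows "point_orbit H y = point_orbit H x"
proof
  have "y \<in> X" using assms point_orbit_subset by blast
  then show "point_orbit H x \<subseteq> point_orbit H y"
    using point_orbit_sym[OF assms] by (rule point_orbit_subsetI)
qed (rule point_orbit_subsetI[OF assms])

lemma point_orbit_eq_iff:
  "x \<in> X \<Longrightarrow> y \<in> X \<Longrightarrow> point_orbit H x = point_orbit H y \<longleftrightarrow> y \<in> point_orbit H x"
  using point_orbit_eq point_orbit_self by metis

end

locale normal_subgroup_orbits = connected_orbital +
  fixes N
  assumes normal: "N \<lhd> perm_group X H"
begin

lemma N_subset: "N \<subseteq> H"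
  using normal by (rule normal_perm_group_subset)

sublocale N: permutation_group X N
proof (rule permutation_group.intro)
  have "subgroup N (perm_group X H)" using normal by (rule normal_imp_subgroup)
  then show "subgroup N (BijGroup X)"
    using group.incl_subgroup[OF group_BijGroup subgroup_BijGroup] by (simp add: perm_group_def)
qed

text \<open>Equality of left and right cosets, evaluated at points: moving past \<open>g\<close>
  changes the element of \<open>N\<close>, but the new element does not depend on the point.\<close>

lemma normal_commute:
  assumes "g \<in> H" "n \<in> N"
  shows "\<exists>m\<in>N. \<forall>x\<in>X. g (n x) = m (g x)" "\<exists>m\<in>N. \<forall>x\<in>X. n (g x) = g (m x)"
proof -
  have n: "n \<in> H" using N_subset assms(2) by blast
  have eq: "N #>\<^bsub>perm_group X H\<^esub> g = g <#\<^bsub>perm_group X H\<^esub> N"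
    using normal.coset_eq[OF normal] assms(1) by simp
  have "g \<otimes>\<^bsub>perm_group X H\<^esub> n \<in> g <#\<^bsub>perm_group X H\<^esub> N"
    using assms by (auto simp: l_coset_def)
  then have "g \<otimes>\<^bsub>perm_group X H\<^esub> n \<in> N #>\<^bsub>perm_group X H\<^esub> g" by (simp add: eq)
  then obtain m where m: "m \<in> N" "compose X g n = m \<otimes>\<^bsub>perm_group X H\<^esub> g"
    using assms n by (auto simp: r_coset_def)
  then have "compose X g n = compose X m g" using assms N_subset by auto
  then have "\<forall>x\<in>X. g (n x) = m (g x)" by (metis compose_eq)
  then show "\<exists>m\<in>N. \<forall>x\<in>X. g (n x) = m (g x)" using m(1) by blast
  have "n \<otimes>\<^bsub>perm_group X H\<^esub> g \<in> N #>\<^bsub>perm_group X H\<^esub> g"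
    using assms by (auto simp: r_coset_def)
  then have "n \<otimes>\<^bsub>perm_group X H\<^esub> g \<in> g <#\<^bsub>perm_group X H\<^esub> N" by (simp add: eq)
  then obtain m where m: "m \<in> N" "compose X n g = g \<otimes>\<^bsub>perm_group X H\<^esub> m"
    using assms n by (auto simp: l_coset_def)
  then have "compose X n g = compose X g m" using assms N_subset by auto
  then have "\<forall>x\<in>X. n (g x) = g (m x)" by (metis compose_eq)
  then show "\<exists>m\<in>N. \<forall>x\<in>X. n (g x) = g (m x)" using m(1) by blast
qed

abbreviation block where "block \<equiv> point_orbit N"
abbreviation blocks where "blocks \<equiv> block ` X"
abbreviation induced where "induced \<equiv> set_action blocks ` H"
abbreviation quotient_orbital where "quotient_orbital \<equiv> map_prod block block ` D"

lemma image_block: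
  assumes "g \<in> H" "x \<in> X" shows "g ` block x = block (g x)"
proof
  show "g ` block x \<subseteq> block (g x)"
    using normal_commute(1)[OF assms(1)] assms(2) by (force simp: point_orbit_def)
  show "block (g x) \<subseteq> g ` block x"
    using normal_commute(2)[OF assms(1)] assms(2) by (force simp: point_orbit_def)
qed

lemma set_action_block [simp]: "g \<in> H \<Longrightarrow> x \<in> X \<Longrightarrow> set_action blocks g (block x) = block (g x)"
  by (simp add: set_action_def image_block)

lemma block_fixed: "n \<in> N \<Longrightarrow> x \<in> X \<Longrightarrow> block (n x) = block x"
  by (intro N.point_orbit_eq) (simp_all add: point_orbit_def)

lemma blocks_disjoint:
  assumes BC: "B \<in> blocks" "C \<in> blocks" "B \<noteq> C" shows "B \<inter> C = {}"
proof (rule ccontr)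
  obtain u v where uv: "u \<in> X" "v \<in> X" "B = block u" "C = block v" using BC by blast
  assume "B \<inter> C \<noteq> {}"
  then obtain z where "z \<in> block u" "z \<in> block v" using uv by blast
  then have "block z = B" "block z = C"
    using N.point_orbit_eq[of u z] N.point_orbit_eq[of v z] uv by simp_all
  then show False using BC(3) by simp
qed

lemma group_action_blocks: "group_action (perm_group X H) blocks (set_action blocks)"
proof (rule group_action_set_action)
  show "blocks \<subseteq> Pow X" using N.point_orbit_subset by blast
qed (auto simp: image_block)

text \<open>Blocks and arcs between them have representatives in \<open>X\<close> and
  \<open>D\<close>, and an element of \<open>H\<close> that does the work on representatives induces
  one that does it on blocks. Paths project arc by arc.\<close>

lemma quotient_connected_orbital: "connected_orbital blocks induced quotient_orbital"
proof (intro connected_orbital.intro transitive_permutation_group.intro permutation_group.intro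
    transitive_permutation_group_axioms.intro connected_orbital_axioms.intro)
  show "subgroup induced (BijGroup blocks)"
    by (rule subgroup_image[OF group_action_blocks])
  show "finite blocks" using finite_domain by simp
  show "blocks \<noteq> {}" using nonempty by simp
  show "\<exists>g\<in>induced. g B = C" if BC: "B \<in> blocks" "C \<in> blocks" for B C
  proof -
    obtain x y where xy: "B = block x" "C = block y" "x \<in> X" "y \<in> X" using BC by blast
    then obtain g where "g \<in> H" "g x = y" using transitive by blast
    then show ?thesis using xy by (intro bexI[of _ "set_action blocks g"]) auto
  qed
  show "quotient_orbital \<subseteq> blocks \<times> blocks" using orbital_subset by auto
  show "quotient_orbital \<noteq> {}" using orbital_nonempty by simp
  show "(g B, g C) \<in> quotient_orbital" if gBC: "g \<in> induced" "(B, C) \<in> quotient_orbital" for g B C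
  proof -
    obtain h x y where h: "g = set_action blocks h" "h \<in> H"
      and xy: "B = block x" "C = block y" "(x, y) \<in> D" using gBC by auto
    have "x \<in> X" "y \<in> X" using xy orbital_subset by auto
    then have "(g B, g C) = map_prod block block (h x, h y)" using xy h by simp
    then show ?thesis using orbital_closed[OF h(2) xy(3)] by (metis imageI)
  qed
  show "\<exists>g\<in>induced. g B = B' \<and> g C = C'"
    if BC: "(B, C) \<in> quotient_orbital" "(B', C') \<in> quotient_orbital" for B C B' C'
  proof -
    obtain x y where xy: "B = block x" "C = block y" "(x, y) \<in> D" using BC(1) by auto
    obtain x' y' where xy': "B' = block x'" "C' = block y'" "(x', y') \<in> D" using BC(2) by auto
    obtain g where g: "g \<in> H" "g x = x'" "g y = y'"
      using orbital_transitive[OF xy(3) xy'(3)] by blast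
    have "x \<in> X" "y \<in> X" using xy orbital_subset by auto
    then show ?thesis using g xy xy' by (intro bexI[of _ "set_action blocks g"]) auto
  qed
  show "(B, C) \<in> (quotient_orbital \<union> quotient_orbital\<inverse>)\<^sup>*" if BC: "B \<in> blocks" "C \<in> blocks" for B C
  proof -
    obtain x y where xy: "B = block x" "C = block y" "x \<in> X" "y \<in> X" using BC by blast
    have "(block x, block y) \<in> (quotient_orbital \<union> quotient_orbital\<inverse>)\<^sup>*"
      using orbital_connected[OF xy(3,4)]
    proof (induction rule: rtrancl_induct)
      case (step y z)
      have "(block y, block z) \<in> quotient_orbital \<union> quotient_orbital\<inverse>" using step(2) by force
      then show ?case using step(3) by (rule rtrancl_into_rtrancl[rotated])
    qed simp
    then show ?thesis using xy by simp
  qed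
qed

sublocale Q: connected_orbital blocks induced quotient_orbital
  by (rule quotient_connected_orbital)

lemma quotient_orbital_converse: "map_prod block block ` (D\<inverse>) = quotient_orbital\<inverse>"
  by force

lemma converse: "normal_subgroup_orbits X H (D\<inverse>) N"
  unfolding normal_subgroup_orbits_def normal_subgroup_orbits_axioms_def
  using normal connected_orbital_converse by blast

text \<open>\<open>N\<close> is transitive on a block \<open>B\<close> and fixes every other block, so \<open>H\<close> is transitive on the
  pairs consisting of a point of \<open>B\<close> and a block joined to \<open>B\<close>.\<close>

lemma transitive_point_block:
  assumes "x \<in> X" "x' \<in> X" "(block x, C) \<in> quotient_orbital" "(block x', C') \<in> quotient_orbital"
  shows "\<exists>g\<in>H. g x = x' \<and> g ` C = C'"
proof -
  obtain h where h: "h \<in> H" "set_action blocks h (block x) = block x'" "set_action blocks h C = C'"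
    using Q.orbital_transitive[OF assms(3,4)] by auto
  have C: "C \<in> blocks" "C' \<in> blocks" using assms(3,4) Q.orbital_subset by auto
  have "block (h x) = block x'" using h assms(1) by simp
  then have "x' \<in> block (h x)" using h(1) assms(1,2) N.point_orbit_self by auto
  then obtain n where n: "n \<in> N" "x' = n (h x)" by (auto simp: point_orbit_def)
  show ?thesis
  proof (intro bexI conjI)
    show "compose X n h \<in> H" using compose_mem n(1) h(1) N_subset by blast
    show "compose X n h x = x'" using assms(1) n(2) by (simp add: compose_eq)
    have "compose X n h ` C = (\<lambda>x. n (h x)) ` C"
    proof (rule image_cong)
      fix z assume "z \<in> C"
      then have "z \<in> X" using C(1) N.point_orbit_subset by auto
      then show "compose X n h z = n (h z)" by (simp add: compose_eq)
    qed simp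
    also have "\<dots> = n ` h ` C" by (simp add: image_image)
    also have "h ` C = C'" using h(3) C(1) by (simp add: set_action_def)
    also have "n ` C' = C'"
    proof -
      obtain y where y: "y \<in> X" "C' = block y" using C(2) by blast
      have "n \<in> H" using n(1) N_subset by blast
      then show ?thesis using y n(1) image_block block_fixed by simp
    qed
    finally show "compose X n h ` C = C'" .
  qed
qed

lemma card_out_block_eq:
  assumes "x \<in> X" "x' \<in> X" "(block x, C) \<in> quotient_orbital" "(block x', C') \<in> quotient_orbital"
  shows "card (D `` {x} \<inter> C) = card (D `` {x'} \<inter> C')"
proof -
  obtain g where g: "g \<in> H" "g x = x'" "g ` C = C'" using transitive_point_block[OF assms] by blast
  have "C \<in> blocks" using assms(3) Q.orbital_subset by auto
  then have C: "C \<subseteq> X" using N.point_orbit_subset by blast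
  have "g ` (D `` {x} \<inter> C) = D `` {x'} \<inter> C'"
    using inj_on_image_Int[OF inj[OF g(1)] out_subset C] image_out[OF g(1) assms(1)] g(2,3) by simp
  moreover have "inj_on g (D `` {x} \<inter> C)"
    using inj[OF g(1)] C by (meson inf.coboundedI2 inj_on_subset)
  ultimately show ?thesis by (metis card_image)
qed

text \<open>The out-neighbours of \<open>x\<close> are sorted by block, and by transitivity on pairs
  of a point and a block every block receives the same share. In particular the valency of the
  quotient divides that of \<open>D\<close>.\<close>

lemma card_out_factor:
  assumes x: "x \<in> X" and C: "(block x, C) \<in> quotient_orbital"
  shows "card (D `` {x}) = card (quotient_orbital `` {block x}) * card (D `` {x} \<inter> C)"
proof -
  let ?Q = "quotient_orbital `` {block x}"
  have "D `` {x} = (\<Union>C\<in>?Q. D `` {x} \<inter> C)"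
  proof
    show "D `` {x} \<subseteq> (\<Union>C\<in>?Q. D `` {x} \<inter> C)"
    proof
      fix y assume y: "y \<in> D `` {x}"
      then have "y \<in> block y" using orbital_subset N.point_orbit_self by auto
      moreover have "block y \<in> ?Q" using y by force
      ultimately show "y \<in> (\<Union>C\<in>?Q. D `` {x} \<inter> C)" using y by blast
    qed
  qed blast
  then have "card (D `` {x}) = card (\<Union>C\<in>?Q. D `` {x} \<inter> C)" by (rule arg_cong)
  also have "\<dots> = (\<Sum>C\<in>?Q. card (D `` {x} \<inter> C))"
  proof (rule card_UN_disjoint)
    show "finite ?Q" by (rule Q.finite_out)
    show "\<forall>C\<in>?Q. finite (D `` {x} \<inter> C)" using finite_out by blast
    show "\<forall>B\<in>?Q. \<forall>C\<in>?Q. B \<noteq> C \<longrightarrow> D `` {x} \<inter> B \<inter> (D `` {x} \<inter> C) = {}"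
    proof (intro ballI impI)
      fix B C assume "B \<in> ?Q" "C \<in> ?Q" "B \<noteq> C"
      then have "B \<inter> C = {}" by (intro blocks_disjoint subsetD[OF Q.out_subset])
      then show "D `` {x} \<inter> B \<inter> (D `` {x} \<inter> C) = {}" by blast
    qed
  qed
  also have "\<dots> = (\<Sum>C'\<in>?Q. card (D `` {x} \<inter> C))"
    by (rule sum.cong[OF refl], rule card_out_block_eq[OF x x _ C]) simp
  finally show ?thesis by simp
qed

lemma out_inter_block_empty:
  assumes "x \<in> X" "C \<in> blocks" "(block x, C) \<notin> quotient_orbital"
  shows "D `` {x} \<inter> C = {}"
proof (rule ccontr)
  assume "D `` {x} \<inter> C \<noteq> {}"
  then obtain y where y: "(x, y) \<in> D" "y \<in> C" by blast
  obtain v where "v \<in> X" "C = block v" using assms(2) by blast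
  then have "block y = C" using y(2) N.point_orbit_eq by simp
  moreover have "(block x, block y) \<in> quotient_orbital" using y(1) by force
  ultimately show False using assms(3) by simp
qed

text \<open>If the quotient has the same valency, an element that fixes all blocks and a point fixes the
  neighbours of that point, hence everything.\<close>

lemma fixes_blocks_and_point_imp_id:
  assumes valency: "\<And>x. x \<in> X \<Longrightarrow> card (quotient_orbital `` {block x}) = card (D `` {x})"
    and g: "g \<in> H" "\<And>x. x \<in> X \<Longrightarrow> block (g x) = block x"
    and x: "x \<in> X" "g x = x"
  shows "g = (\<lambda>x\<in>X. x)"
proof -
  interpret C: normal_subgroup_orbits X H "D\<inverse>" N by (rule converse)
  have pos: "card (D `` {y}) > 0" if "y \<in> X" for y
    using out_nonempty[OF that] finite_out by (simp add: card_gt_0_iff)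
  \<comment> \<open>With equal positive valencies the remaining factor is 1, so \<open>y\<close> has
    a single out-neighbour in \<open>C\<close>; \<open>out'\<close> is the same for
    in-neighbours.\<close>
  have out: "card (D `` {y} \<inter> C) = 1" if "y \<in> X" "(block y, C) \<in> quotient_orbital" for y C
    using card_out_factor[OF that] valency[OF that(1)] pos[OF that(1)] by simp
  have out': "card (D\<inverse> `` {y} \<inter> C) = 1" if "y \<in> X" "(C, block y) \<in> quotient_orbital" for y C
  proof -
    have "card (quotient_orbital\<inverse> `` {block y}) = card (D\<inverse> `` {y})"
      using Q.card_in_eq_card_out[of "block y"] card_in_eq_card_out[OF that(1)]
        valency[OF that(1)] that(1) by simp
    then show ?thesis
      using C.card_out_factor[of y C] that pos[OF that(1)] card_in_eq_card_out[OF that(1)]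
      by (simp add: quotient_orbital_converse)
  qed
  have "{y \<in> X. g y = y} = X"
  proof (rule connected_closure[of x])
    fix u v assume u: "u \<in> {y \<in> X. g y = y}" and uv: "(u, v) \<in> D \<union> D\<inverse>"
    have v: "v \<in> X" using uv orbital_subset by blast
    have gv: "g v \<in> block v" "v \<in> block v"
      using g v N.point_orbit_self[of v] N.point_orbit_self[of "g v"] by auto
    consider "(u, v) \<in> D" | "(v, u) \<in> D" using uv by blast
    then have "g v = v"
    proof cases
      case 1
      then have "(u, g v) \<in> D" using orbital_closed[OF g(1) 1] u by simp
      moreover have "card (D `` {u} \<inter> block v) = 1" using out[of u "block v"] u 1 by force
      then obtain w where "D `` {u} \<inter> block v = {w}" by (meson card_1_singletonE)
      ultimately show ?thesis using 1 gv by (metis (lifting) Image_singleton_iff IntI singletonD)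
    next
      case 2
      then have "(g v, u) \<in> D" using orbital_closed[OF g(1) 2] u by simp
      moreover have "card (D\<inverse> `` {u} \<inter> block v) = 1" using out'[of u "block v"] u 2 by force
      then obtain w where "D\<inverse> `` {u} \<inter> block v = {w}" by (meson card_1_singletonE)
      ultimately show ?thesis using 2 gv by (metis (lifting) Image_singleton_iff IntI converseI singletonD)
    qed
    then show "v \<in> {y \<in> X. g y = y}" using v by simp
  qed (use x in auto)
  then show ?thesis by (intro eqI[OF g(1) id_mem]) auto
qed

text \<open>At one point \<open>g\<close> agrees with some \<open>n\<close> in \<open>N\<close>,
  because it keeps the block of that point. The inverse of \<open>n\<close> after \<open>g\<close>
  then fixes all blocks and a point, hence is the identity.\<close>

lemma fixes_blocks_imp_mem:
  assumes valency: "\<And>x. x \<in> X \<Longrightarrow> card (quotient_orbital `` {block x}) = card (D `` {x})"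
    and g: "g \<in> H" "\<And>x. x \<in> X \<Longrightarrow> block (g x) = block x"
  shows "g \<in> N"
proof -
  obtain x where x: "x \<in> X" using nonempty by blast
  have "g x \<in> block x" using g x N.point_orbit_self[of "g x"] by simp
  then obtain n where n: "n \<in> N" "g x = n x" by (auto simp: point_orbit_def)
  obtain m where m: "m \<in> N" "\<And>x. x \<in> X \<Longrightarrow> m (n x) = x" "\<And>x. x \<in> X \<Longrightarrow> n (m x) = x"
    using N.ex_inverse[OF n(1)] by blast
  have mH: "m \<in> H" using m(1) N_subset by blast
  have "compose X m g = (\<lambda>x\<in>X. x)"
  proof (rule fixes_blocks_and_point_imp_id[OF valency])
    show "compose X m g \<in> H" using compose_mem[OF mH g(1)] .
    show "block (compose X m g y) = block y" if "y \<in> X" for y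
      using that g m(1) block_fixed by (simp add: compose_eq)
    show "compose X m g x = x" using x n(2) m(2) by (simp add: compose_eq)
  qed (use x in auto)
  then have *: "m (g y) = y" if "y \<in> X" for y
    using that by (metis compose_eq restrict_apply')
  have "g y = n y" if "y \<in> X" for y
    using *[OF that] m(3)[of "g y"] that g(1) by simp
  then have "g = n" using g(1) n(1) N_subset by (intro eqI) auto
  then show ?thesis using n(1) by simp
qed

end

section \<open>Groups acting on cycles\<close>

text \<open>The explicit formulas below map a model group into permutations, opposite to the wanted
  direction. Asking only for closure of \<open>A\<close> spares a proof that
  \<open>dihedral_group r\<close> is a group.\<close>

lemma is_iso_inverseI:
  assumes "h \<in> hom A B" "bij_betw h (carrier A) (carrier B)"
    and "\<And>x y. x \<in> carrier A \<Longrightarrow> y \<in> carrier A \<Longrightarrow> x \<otimes>\<^bsub>A\<^esub> y \<in> carrier A"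
  shows "B \<cong> A"
proof (rule is_isoI)
  let ?k = "inv_into (carrier A) h"
  have k: "bij_betw ?k (carrier B) (carrier A)" using assms(2) by (rule bij_betw_inv_into)
  have "?k (x \<otimes>\<^bsub>B\<^esub> y) = ?k x \<otimes>\<^bsub>A\<^esub> ?k y" if xy: "x \<in> carrier B" "y \<in> carrier B" for x y
  proof -
    have kxy: "?k x \<in> carrier A" "?k y \<in> carrier A" using xy k bij_betwE by blast+
    have "h (?k x \<otimes>\<^bsub>A\<^esub> ?k y) = x \<otimes>\<^bsub>B\<^esub> y"
      using hom_mult[OF assms(1) kxy] xy assms(2) by (simp add: bij_betw_inv_into_right)
    then show ?thesis
      using assms(2,3) kxy by (metis bij_betw_inv_into_left)
  qed
  then show "?k \<in> Group.iso B A"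
    using k bij_betwE by (fastforce simp: Group.iso_def hom_def)
qed

text \<open>The points are reached from \<open>y\<close> by powers of \<open>h\<close>;
  \<open>gen\<close> says that \<open>h\<close> and its inverse generate everything from
  \<open>y\<close>. Integer indices allow predecessors and reflections to be written without case
  distinctions.\<close>

lemma (in transitive_permutation_group) ex_cyclic_enumeration:
  assumes h: "h \<in> H" and y: "y \<in> X"
    and gen: "\<And>S. y \<in> S \<Longrightarrow> S \<subseteq> X \<Longrightarrow> (\<And>u. u \<in> S \<Longrightarrow> h u \<in> S)
      \<Longrightarrow> (\<And>u. u \<in> X \<Longrightarrow> h u \<in> S \<Longrightarrow> u \<in> S) \<Longrightarrow> S = X"
  shows "\<exists>(e :: int \<Rightarrow> _) r. r > 0 \<and> range e = X \<and> e 0 = y \<and> (\<forall>i. h (e i) = e (i + 1))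
    \<and> (\<forall>i j. e i = e j \<longleftrightarrow> i mod int r = j mod int r)"
proof -
  define f where "f i = (h ^^ i) y" for i :: nat
  have f_Suc: "f (Suc i) = h (f i)" and f0: "f 0 = y" for i by (simp_all add: f_def)
  have fX: "f i \<in> X" for i by (induction i) (simp_all add: f0 f_Suc y h)
  \<comment> \<open>Injectivity of \<open>h\<close> pulls a repetition back to the start, so the
    sequence is purely periodic.\<close>
  have cancel: "f k = y" if "f (i + k) = f i" for i k
    using that by (induction i) (simp_all add: f0 f_Suc fX h)
  \<comment> \<open>Pigeonhole: this range contains \<open>card X + 1\<close> exponents.\<close>
  have "\<not> inj_on f {..card X}"
  proof
    assume "inj_on f {..card X}"
    then have "card {..card X} \<le> card X"
      by (rule card_inj_on_le) (use fX finite_domain in auto)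
    then show False by simp
  qed
  then obtain i j where "i < j" "f i = f j"
    by (auto simp: inj_on_def) (metis linorder_neqE_nat)
  then have "j - i > 0 \<and> f (j - i) = y" using cancel[of i "j - i"] by simp
  then have ex: "\<exists>k. k > 0 \<and> f k = y" by blast
  define r where "r = (LEAST k. k > 0 \<and> f k = y)"
  have r: "r > 0" "f r = y" using LeastI_ex[OF ex] by (simp_all add: r_def)
  have r_least: "r \<le> k" if "k > 0" "f k = y" for k
    unfolding r_def using that by (intro Least_le) simp
  have f_mod: "f (i mod r) = f i" for i
    using funpow_mod_eq[of r h y i] r(2) by (simp add: f_def)
  have f_less: "i = j" if "i \<le> j" "j < r" "f i = f j" for i j
    using r_least[of "j - i"] cancel[of i "j - i"] that by (cases "i = j") auto
  have f_inj: "i = j" if "i < r" "j < r" "f i = f j" for i j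
    using f_less[of i j] f_less[of j i] that by (cases "i \<le> j") auto
  define e where "e i = f (nat (i mod int r))" for i :: int
  have eq: "e i = e j \<longleftrightarrow> i mod int r = j mod int r" for i j
  proof
    assume "e i = e j"
    then have "nat (i mod int r) = nat (j mod int r)"
      using r(1) by (intro f_inj) (simp_all add: e_def nat_less_iff)
    then show "i mod int r = j mod int r" using r(1) by (simp add: eq_nat_nat_iff)
  qed (simp add: e_def)
  have step: "h (e i) = e (i + 1)" for i
  proof -
    have "int (Suc (nat (i mod int r)) mod r) = (i + 1) mod int r"
      using r(1) by (simp add: zmod_int mod_add_right_eq add.commute)
    then have "nat ((i + 1) mod int r) = Suc (nat (i mod int r)) mod r" by (metis nat_int)
    then show ?thesis by (simp add: e_def f_mod f_Suc)
  qed
  have e0: "e 0 = y" by (simp add: e_def f0)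
  have eX: "e i \<in> X" for i by (simp add: e_def fX)
  have "range e = X"
  proof (rule gen)
    show "y \<in> range e" using e0 by (metis rangeI)
    fix u assume u: "u \<in> X" "h u \<in> range e"
    \<comment> \<open>Writing the index as \<open>i - 1 + 1\<close> exposes the step equation, and
      injectivity of \<open>h\<close> then yields the predecessor.\<close>
    then obtain i where "h u = e (i - 1 + 1)" by auto
    then have "h u = h (e (i - 1))" by (simp only: step)
    then have "u = e (i - 1)" using u(1) eX h by simp
    then show "u \<in> range e" by simp
  qed (use eX step in auto)
  then show ?thesis using r(1) e0 step eq by blast
qed

text \<open>\<open>e\<close> identifies \<open>X\<close> with the integers modulo \<open>r\<close>,
  as a periodic map instead of a bijection from residues. How \<open>H\<close> acts on the cycle is
  left to the hypotheses of the individual results.\<close>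

locale cyclic_enumeration = permutation_group +
  fixes e :: "int \<Rightarrow> 'a" and r :: nat
  assumes r_pos: "r > 0"
    and range_e: "range e = X"
    and e_eq: "e i = e j \<longleftrightarrow> i mod int r = j mod int r"
begin

lemma e_mem [simp]: "e i \<in> X"
  using range_e by blast

lemma memE: assumes "x \<in> X" obtains i where "x = e i"
  using assms range_e by blast

lemma bij_betw_e: "bij_betw e {0..<int r} X"
proof (rule bij_betw_imageI)
  show "inj_on e {0..<int r}" by (rule inj_onI) (simp add: e_eq)
  have "e i \<in> e ` {0..<int r}" for i
    by (rule image_eqI[of _ _ "i mod int r"]) (use r_pos in \<open>simp_all add: e_eq\<close>)
  then show "e ` {0..<int r} = X" using range_e by auto
qed

lemma card_domain: "card X = r"
  using bij_betw_same_card[OF bij_betw_e] by simp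

definition index where "index x = inv_into {0..<int r} e x"

lemma index_e [simp]: "index (e i) = i mod int r"
proof -
  have "e i = e (i mod int r)" by (simp add: e_eq)
  then show ?thesis
    using bij_betw_inv_into_left[OF bij_betw_e, of "i mod int r"] r_pos by (simp add: index_def)
qed

text \<open>The map \<open>c + s * i\<close> on residues: a rotation for \<open>s = 1\<close>, a
  reflection for \<open>s = - 1\<close>. It is restricted to \<open>X\<close> so that it can equal
  an element of \<open>H\<close>.\<close>

definition affine :: "int \<Rightarrow> int \<Rightarrow> 'a \<Rightarrow> 'a" where
  "affine s c = (\<lambda>x\<in>X. e (c + s * index x))"

lemma affine_e [simp]: "affine s c (e i) = e (c + s * i)"
  by (simp add: affine_def e_eq) (metis mod_add_right_eq mod_mult_right_eq)

lemma affine_eqI: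
  assumes "f \<in> extensional X" "\<And>i. f (e i) = e (c + s * i)"
  shows "f = affine s c"
proof (rule extensionalityI[OF assms(1)])
  show "affine s c \<in> extensional X" by (simp add: affine_def)
  fix x assume "x \<in> X"
  then obtain i where "x = e i" by (rule memE)
  then show "f x = affine s c x" using assms(2) by simp
qed

lemma extensional: "g \<in> H \<Longrightarrow> g \<in> extensional X"
  using in_Bij Bij_imp_extensional by blast

text \<open>This is the multiplication of \<open>dihedral_group\<close>, with a sign in place of the
  Boolean.\<close>

lemma compose_affine: "compose X (affine s c) (affine t d) = affine (s * t) (c + s * d)"
proof (rule affine_eqI)
  fix i
  show "compose X (affine s c) (affine t d) (e i) = e (c + s * d + s * t * i)"
    by (simp add: compose_eq algebra_simps)
qed (simp add: compose_extensional)

lemma affine_mod: "affine s (c mod int r) = affine s c"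
proof (rule affine_eqI)
  fix i show "affine s (c mod int r) (e i) = e (c + s * i)"
    by (simp add: e_eq mod_add_left_eq)
qed (simp add: affine_def)

lemma rotation_if_steps_preserved:
  assumes g: "g \<in> H" and step: "\<And>i j. g (e i) = e j \<Longrightarrow> g (e (i + 1)) = e (j + 1)"
    and c: "g (e 0) = e c"
  shows "g = affine 1 c"
proof (rule affine_eqI[OF extensional[OF g]])
  fix i show "g (e i) = e (c + 1 * i)"
  proof (induction i rule: int_induct[of _ 0])
    case (step1 i)
    then show ?case using step[of i "c + i"] by (simp add: add.assoc)
  next
    case (step2 i)
    \<comment> \<open>Downwards, the step hypothesis is applied to the still unknown image of
      \<open>e (i - 1)\<close>, and the added 1 is cancelled modulo \<open>r\<close>.\<close>
    obtain j where j: "g (e (i - 1)) = e j" using closed[OF g e_mem] memE by blast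
    have "e (j + 1) = e (c + i)" using step[OF j] step2 by simp
    then have "e j = e (c + i - 1)" by (simp add: e_eq) (metis add_diff_cancel_right' mod_diff_left_eq)
    then show ?case using j by (simp add: algebra_simps)
  qed (simp add: c)
qed

text \<open>An element that preserves steps is the rotation given by its value at
  \<open>e 0\<close>, and transitivity makes every rotation occur.\<close>

theorem perm_group_iso_cyclic:
  assumes step: "\<And>g i j. g \<in> H \<Longrightarrow> g (e i) = e j \<Longrightarrow> g (e (i + 1)) = e (j + 1)"
    and trans: "\<And>c. \<exists>g\<in>H. g (e 0) = e c"
  shows "perm_group X H \<cong> integer_mod_group r"
proof (rule is_iso_inverseI)
  have rotation: "g = affine 1 c" if "g \<in> H" "g (e 0) = e c" for g c
    by (rule rotation_if_steps_preserved[OF that(1) _ that(2)]) (rule step[OF that(1)])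
  have mem: "affine 1 c \<in> H" for c
    using trans[of c] rotation by blast
  show "affine 1 \<in> hom (integer_mod_group r) (perm_group X H)"
    by (rule homI) (simp_all add: mem compose_affine affine_mod)
  have "inj_on (affine 1) {0..<int r}"
  proof (rule inj_onI)
    fix c d assume cd: "c \<in> {0..<int r}" "d \<in> {0..<int r}" "affine 1 c = affine 1 d"
    then have "affine 1 c (e 0) = affine 1 d (e 0)" by simp
    then show "c = d" using cd(1,2) by (simp add: e_eq)
  qed
  moreover have "affine 1 ` {0..<int r} = H"
  proof
    show "H \<subseteq> affine 1 ` {0..<int r}"
    proof
      fix g assume g: "g \<in> H"
      obtain c where "g (e 0) = e c" using closed[OF g e_mem] memE by blast
      then have "g = affine 1 (c mod int r)" using rotation[OF g] by (simp only: affine_mod)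
      then show "g \<in> affine 1 ` {0..<int r}" using r_pos by simp
    qed
  qed (use mem in auto)
  ultimately show "bij_betw (affine 1) (carrier (integer_mod_group r)) (carrier (perm_group X H))"
    using r_pos by (simp add: bij_betw_def carrier_integer_mod_group)
qed (use r_pos in \<open>simp add: carrier_integer_mod_group\<close>)

text \<open>The images of \<open>e 0\<close> and \<open>e 1\<close> fix a start and a direction;
  from then on, one neighbour of each point is already placed and the other has only one position
  left.\<close>

lemma affine_if_neighbours_preserved:
  assumes g: "g \<in> H"
    and nbr: "\<And>i j. g (e i) = e j \<Longrightarrow> {g (e (i + 1)), g (e (i - 1))} = {e (j + 1), e (j - 1)}"
    and s: "s = 1 \<or> s = - 1" and c: "g (e 0) = e c" "g (e 1) = e (c + s)"
  shows "g = affine s c"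
proof (rule affine_eqI[OF extensional[OF g]])
  have nbr': "{g (e (i + 1)), g (e (i - 1))} = {e (j + s), e (j - s)}" if "g (e i) = e j" for i j
    using nbr[OF that] s by (cases "s = 1") (simp_all add: insert_commute)
  \<comment> \<open>Two consecutive values are carried along, because a pair of neighbours
    determines one member only when the other is known.\<close>
  have "g (e i) = e (c + s * i) \<and> g (e (i + 1)) = e (c + s * (i + 1))" for i
  proof (induction i rule: int_induct[of _ 0])
    case (step1 i)
    have "{g (e (i + 1 + 1)), g (e i)} = {e (c + s * (i + 1 + 1)), e (c + s * i)}"
      using nbr'[OF conjunct2[OF step1(2)]] by (simp add: algebra_simps)
    then show ?case using step1(2) by (simp add: doubleton_eq_iff) auto
  next
    case (step2 i)
    have "{g (e (i + 1)), g (e (i - 1))} = {e (c + s * (i + 1)), e (c + s * (i - 1))}"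
      using nbr'[OF conjunct1[OF step2(2)]] by (simp add: algebra_simps)
    then show ?case using step2(2) by (simp add: doubleton_eq_iff) auto
  qed (simp add: c)
  then show "g (e i) = e (c + s * i)" for i by blast
qed

text \<open>An element is determined by the images of \<open>e 0\<close> and \<open>e 1\<close>,
  hence by a residue and a sign: \<open>nbr\<close> admits no other choices and \<open>trans\<close>
  realises all of these.\<close>

theorem perm_group_iso_dihedral:
  assumes r: "r \<ge> 3"
    and nbr: "\<And>g i j. g \<in> H \<Longrightarrow> g (e i) = e j \<Longrightarrow> {g (e (i + 1)), g (e (i - 1))} = {e (j + 1), e (j - 1)}"
    and trans: "\<And>c s. s = 1 \<or> s = - 1 \<Longrightarrow> \<exists>g\<in>H. g (e 0) = e c \<and> g (e 1) = e (c + s)"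
  shows "perm_group X H \<cong> dihedral_group r"
proof (rule is_iso_inverseI)
  let ?sgn = "\<lambda>b :: bool. if b then - 1 else 1 :: int"
  let ?f = "\<lambda>(c, b). affine (?sgn b) c"
  have carrier: "carrier (dihedral_group r) = {0..<int r} \<times> UNIV"
    using r_pos by (simp add: dihedral_group_def carrier_integer_mod_group)
  \<comment> \<open>Exclusive or of the Booleans is the product of the signs, which turns
    multiplication in \<open>dihedral_group r\<close> into composition of affine maps.\<close>
  have sgn_neq: "?sgn (b \<noteq> b') = ?sgn b * ?sgn b'" for b b' by auto
  have affine: "g = affine s c"
    if "g \<in> H" "s = 1 \<or> s = - 1" "g (e 0) = e c" "g (e 1) = e (c + s)" for g s c
    by (rule affine_if_neighbours_preserved[OF that(1) _ that(2-4)]) (rule nbr[OF that(1)])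
  have mem: "affine s c \<in> H" if "s = 1 \<or> s = - 1" for s c
    using trans[OF that, of c] affine[OF _ that] by blast
  show "?f \<in> hom (dihedral_group r) (perm_group X H)"
  proof (rule homI)
    fix p q assume "p \<in> carrier (dihedral_group r)" "q \<in> carrier (dihedral_group r)"
    obtain c b where p: "p = (c, b)" by fastforce
    obtain d b' where q: "q = (d, b')" by fastforce
    have "p \<otimes>\<^bsub>dihedral_group r\<^esub> q = ((c + ?sgn b * d) mod int r, b \<noteq> b')"
      by (simp add: p q dihedral_group_def)
    then have "?f (p \<otimes>\<^bsub>dihedral_group r\<^esub> q) = affine (?sgn b * ?sgn b') (c + ?sgn b * d)"
      by (simp only: prod.case sgn_neq affine_mod)
    also have "\<dots> = compose X (?f p) (?f q)" by (simp only: p q prod.case compose_affine)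
    finally show "?f (p \<otimes>\<^bsub>dihedral_group r\<^esub> q) = ?f p \<otimes>\<^bsub>perm_group X H\<^esub> ?f q"
      using mem by (simp add: p q)
  qed (auto simp: mem)
  have "inj_on ?f ({0..<int r} \<times> UNIV)"
  proof (rule inj_onI, clarify)
    fix c b d b'
    assume cd: "c \<in> {0..<int r}" "d \<in> {0..<int r}" and eq: "affine (?sgn b) c = affine (?sgn b') d"
    have "affine (?sgn b) c (e 0) = affine (?sgn b') d (e 0)" using eq by simp
    then have "c = d" using cd(1,2) by (simp add: e_eq)
    moreover have "b = b'"
    proof (rule ccontr)
      assume "b \<noteq> b'"
      have "affine (?sgn b) c (e 1) = affine (?sgn b') d (e 1)" using eq by simp
      then have "int r dvd (c + ?sgn b) - (d + ?sgn b')" by (simp add: e_eq mod_eq_dvd_iff)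
      then have "int r dvd ?sgn b - ?sgn b'" using \<open>c = d\<close> by simp
      \<comment> \<open>A rotation and a reflection that agree at \<open>e 0\<close> and
        \<open>e 1\<close> would make \<open>c + 1\<close> and \<open>c - 1\<close> congruent;
        \<open>r \<ge> 3\<close> excludes this.\<close>
      then have "int r dvd 2" using \<open>b \<noteq> b'\<close> by (cases b; cases b') simp_all
      then show False using r by (auto dest: zdvd_imp_le)
    qed
    ultimately show "c = d \<and> b = b'" by simp
  qed
  moreover have "?f ` ({0..<int r} \<times> UNIV) = H"
  proof
    show "H \<subseteq> ?f ` ({0..<int r} \<times> UNIV)"
    proof
      fix g assume g: "g \<in> H"
      obtain c where c: "g (e 0) = e c" using closed[OF g e_mem] memE by blast
      have "g (e 1) = e (c + 1) \<or> g (e 1) = e (c - 1)"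
        using nbr[OF g c] by (auto simp: doubleton_eq_iff)
      then obtain b where "g (e 1) = e (c + ?sgn b)" by (metis diff_conv_add_uminus)
      then have "g = affine (?sgn b) c" using affine[OF g _ c, of "?sgn b"] by (cases b) simp_all
      then have "g = affine (?sgn b) (c mod int r)" by (simp only: affine_mod)
      then have "g = ?f (c mod int r, b)" by simp
      moreover have "(c mod int r, b) \<in> {0..<int r} \<times> UNIV" using r_pos by simp
      ultimately show "g \<in> ?f ` ({0..<int r} \<times> UNIV)" by (rule image_eqI)
    qed
  qed (auto simp: mem)
  ultimately show "bij_betw ?f (carrier (dihedral_group r)) (carrier (perm_group X H))"
    by (simp add: bij_betw_def carrier)
  show "x \<otimes>\<^bsub>dihedral_group r\<^esub> y \<in> carrier (dihedral_group r)" for x y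
    using r_pos by (cases x; cases y) (simp add: carrier, simp add: dihedral_group_def)
qed

text \<open>The isomorphism takes the residue in \<open>{0..<r}\<close> and acts componentwise on
  arcs. Any positive \<open>r\<close> is allowed, so that the length of a directed cycle need not be
  known beforehand.\<close>

theorem digraph_iso_cycle_graph:
  assumes \<Gamma>: "pverts \<Gamma> = X" "pair_wf_digraph \<Gamma>"
    and arcs: "\<And>i j. (e i, e j) \<in> parcs \<Gamma> \<longleftrightarrow> e j = e (i + 1) \<or> e i = e (j + 1)"
  shows "digraph_iso (with_proj \<Gamma>) (with_proj (cycle_graph r))"
proof -
  let ?k = "\<lambda>x. nat (index x)"
  let ?iso = "\<lparr>iso_verts = ?k, iso_arcs = map_prod ?k ?k, iso_head = snd, iso_tail = fst\<rparr>"
  have k_less: "?k x < r" if x: "x \<in> X" for x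
  proof -
    obtain i where "x = e i" using x by (rule memE)
    then show ?thesis using r_pos by (simp add: nat_less_iff)
  qed
  have e_k: "e (int (?k x)) = x" if x: "x \<in> X" for x
  proof -
    obtain i where "x = e i" using x by (rule memE)
    then show ?thesis using r_pos by (simp add: e_eq)
  qed
  have k_e: "?k (e (int i)) = i" if "i < r" for i
    using that by (simp add: nat_mod_distrib)
  have inj: "inj_on ?k X" by (rule inj_onI) (metis e_k)
  have sub: "parcs \<Gamma> \<subseteq> X \<times> X"
    using pair_wf_digraph.wellformed'[OF \<Gamma>(2)] \<Gamma>(1) by auto
  have cyc: "(i, j) \<in> parcs (cycle_graph r) \<longleftrightarrow> (e (int i), e (int j)) \<in> parcs \<Gamma>" if "i < r" "j < r" for i j
  proof -
    have "e (int j) = e (int i + 1) \<longleftrightarrow> j = Suc i mod r" if "i < r" "j < r" for i j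
    proof -
      have "int (Suc i mod r) = (int i + 1) mod int r" by (simp add: zmod_int add.commute)
      moreover have "int j mod int r = int j" using that by simp
      ultimately show ?thesis by (metis e_eq of_nat_eq_iff)
    qed
    then show ?thesis using that by (simp add: arcs cycle_graph_def)
  qed
  have "pre_digraph.digraph_isomorphism (with_proj \<Gamma>) ?iso"
    unfolding pre_digraph.digraph_isomorphism_def
  proof (intro conjI)
    show "wf_digraph (with_proj \<Gamma>)" using \<Gamma>(2) by (simp add: wf_digraph_wp_iff)
    have "inj_on (map_prod ?k ?k) (parcs \<Gamma>)"
      using map_prod_inj_on[OF inj inj] sub by (rule inj_on_subset)
    then show "inj_on (iso_arcs ?iso) (arcs (with_proj \<Gamma>))" by simp
  qed (simp_all add: inj \<Gamma>(1))
  moreover have "with_proj (cycle_graph r) = app_iso ?iso (with_proj \<Gamma>)"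
  proof -
    have "?k ` X = {..<r}"
    proof
      show "{..<r} \<subseteq> ?k ` X"
      proof
        fix i assume "i \<in> {..<r}"
        then show "i \<in> ?k ` X" by (intro image_eqI[of _ _ "e (int i)"] k_e[symmetric]) simp_all
      qed
    qed (use k_less in auto)
    moreover have "map_prod ?k ?k ` parcs \<Gamma> = parcs (cycle_graph r)"
    proof
      show "map_prod ?k ?k ` parcs \<Gamma> \<subseteq> parcs (cycle_graph r)"
        using sub k_less e_k by (auto simp: cyc)
      show "parcs (cycle_graph r) \<subseteq> map_prod ?k ?k ` parcs \<Gamma>"
      proof clarify
        fix i j assume ij: "(i, j) \<in> parcs (cycle_graph r)"
        then have "i < r" "j < r" by (auto simp: cycle_graph_def)
        then have "(e (int i), e (int j)) \<in> parcs \<Gamma>" "(i, j) = map_prod ?k ?k (e (int i), e (int j))"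
          using ij cyc k_e by auto
        then show "(i, j) \<in> map_prod ?k ?k ` parcs \<Gamma>" by (rule image_eqI[rotated])
      qed
    qed
    moreover have "pverts (cycle_graph r) = {..<r}" by (simp add: cycle_graph_def)
    ultimately show ?thesis using \<Gamma>(1) by (simp add: app_iso_def with_proj_def)
  qed
  ultimately show ?thesis unfolding digraph_iso_def by blast
qed

end

section \<open>Orbitals of valency one and two as cycles\<close>

context connected_orbital
begin

text \<open>An \<open>h\<close> that takes one point to its successor does so everywhere: since
  successors and predecessors are unique, the set of such points is closed under neighbours. The
  powers of \<open>h\<close> then run through the cycle.\<close>

lemma valency_one_cyclic_enumeration:
  assumes valency: "\<And>x. x \<in> X \<Longrightarrow> card (D `` {x}) = 1"
  shows "\<exists>e r. cyclic_enumeration X H e r \<and> (\<forall>i. D `` {e i} = {e (i + 1)})"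
proof -
  have out: "v = w" if "(u, v) \<in> D" "(u, w) \<in> D" for u v w
  proof -
    have "u \<in> X" using that orbital_subset by blast
    then obtain z where "D `` {u} = {z}" using valency by (meson card_1_singletonE)
    then show ?thesis using that by (metis Image_singleton_iff singletonD)
  qed
  have in': "v = w" if "(v, u) \<in> D" "(w, u) \<in> D" for u v w
  proof -
    have "u \<in> X" using that orbital_subset by blast
    then obtain z where "D\<inverse> `` {u} = {z}"
      using valency card_in_eq_card_out by (metis card_1_singletonE)
    then show ?thesis using that by (metis Image_singleton_iff converseI singletonD)
  qed
  obtain y0 y1 where y: "(y0, y1) \<in> D" using orbital_nonempty by auto
  have yX: "y0 \<in> X" "y1 \<in> X" using y orbital_subset by auto
  obtain h where h: "h \<in> H" "h y0 = y1" using transitive[OF yX] by blast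
  have pre: "\<exists>w\<in>X. h w = u" if "u \<in> X" for u
    using ex_inverse[OF h(1)] that closed by blast
  have "{u \<in> X. (u, h u) \<in> D} = X"
  proof (rule connected_closure[of y0])
    fix u v assume u: "u \<in> {u \<in> X. (u, h u) \<in> D}" and uv: "(u, v) \<in> D \<union> D\<inverse>"
    consider "(u, v) \<in> D" | "(v, u) \<in> D" using uv by blast
    then show "v \<in> {u \<in> X. (u, h u) \<in> D}"
    proof cases
      case 1
      then have "v = h u" using u out by blast
      then show ?thesis using u h(1) orbital_closed[OF h(1)] by auto
    next
      case 2
      \<comment> \<open>Pulling the arc \<open>(u, h u)\<close> back by \<open>h\<close> gives
        \<open>(w, u)\<close>, so \<open>w\<close> is the unique predecessor \<open>v\<close> of
        \<open>u\<close>.\<close>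
      obtain w where w: "w \<in> X" "h w = u" using pre u by blast
      then have "(w, u) \<in> D" using u orbital_iff[OF h(1), of w "h w"] h(1) by simp
      then show ?thesis using w in'[OF 2] 2 by auto
    qed
  qed (use y yX h(2) in auto)
  then have D: "(u, h u) \<in> D" if "u \<in> X" for u using that by blast
  have "\<exists>(e :: int \<Rightarrow> _) r. r > 0 \<and> range e = X \<and> e 0 = y0 \<and> (\<forall>i. h (e i) = e (i + 1))
    \<and> (\<forall>i j. e i = e j \<longleftrightarrow> i mod int r = j mod int r)"
  proof (rule ex_cyclic_enumeration[OF h(1) yX(1)])
    fix S assume S: "y0 \<in> S" "S \<subseteq> X" "\<And>u. u \<in> S \<Longrightarrow> h u \<in> S" "\<And>u. u \<in> X \<Longrightarrow> h u \<in> S \<Longrightarrow> u \<in> S"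
    show "S = X"
    proof (rule connected_closure[OF S(1) yX(1) S(2)])
      fix u v assume u: "u \<in> S" and uv: "(u, v) \<in> D \<union> D\<inverse>"
      have "u \<in> X" "v \<in> X" using uv orbital_subset by auto
      then have "v = h u \<or> u = h v" using uv D out by blast
      then show "v \<in> S" using u S(3,4) \<open>v \<in> X\<close> by blast
    qed
  qed
  then obtain e :: "int \<Rightarrow> 'a" and r where e: "r > 0" "range e = X" "\<And>i. h (e i) = e (i + 1)"
    "\<And>i j. e i = e j \<longleftrightarrow> i mod int r = j mod int r" by blast
  have "cyclic_enumeration X H e r"
    by (intro cyclic_enumeration.intro cyclic_enumeration_axioms.intro permutation_group_axioms e)
  moreover have "D `` {e i} = {e (i + 1)}" for i
  proof -
    have "(e i, e (i + 1)) \<in> D" using D[of "e i"] e(2,3) by (metis rangeI)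
    then show ?thesis using out by blast
  qed
  ultimately show ?thesis by blast
qed

text \<open>An element that merely moves \<open>y0\<close> to a neighbour could be a reflection. So
  \<open>h\<close> is chosen to carry the arc \<open>(y0, y1)\<close> to \<open>(y1, y2)\<close>,
  where \<open>y2\<close> is the other neighbour of \<open>y1\<close>; this forces a shift along the
  whole cycle.\<close>

lemma valency_two_cyclic_enumeration:
  assumes sym: "D\<inverse> = D" and valency: "\<And>x. x \<in> X \<Longrightarrow> card (D `` {x}) = 2"
  shows "\<exists>e r. cyclic_enumeration X H e r \<and> (\<forall>i. D `` {e i} = {e (i + 1), e (i - 1)})"
proof -
  obtain y0 y1 where y: "(y0, y1) \<in> D" using orbital_nonempty by auto
  have yX: "y0 \<in> X" "y1 \<in> X" using y orbital_subset by auto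
  have y10: "(y1, y0) \<in> D" using y sym by blast
  obtain a b where ab: "D `` {y1} = {a, b}" "a \<noteq> b"
    using valency[OF yX(2)] by (metis card_2_iff)
  have "y0 = a \<or> y0 = b" using ab(1) y10 by blast
  then obtain y2 where y2: "D `` {y1} = {y2, y0}"
    using ab by (metis insert_commute)
  then have "(y1, y2) \<in> D" by blast
  then obtain h where h: "h \<in> H" "h y0 = y1" "h y1 = y2" using orbital_transitive[OF y] by blast
  have pre: "\<exists>w\<in>X. h w = u" if "u \<in> X" for u
    using ex_inverse[OF h(1)] that closed by blast
  \<comment> \<open>The points at which \<open>h\<close> acts as a shift: the two neighbours are the
    image and the preimage under \<open>h\<close>.\<close>
  define S0 where "S0 = {u \<in> X. \<exists>w\<in>X. h w = u \<and> D `` {u} = {h u, w}}"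
  have pred_mem: "u \<in> S0" if u: "u \<in> X" "h u \<in> S0" for u
  proof -
    obtain w' where w': "w' \<in> X" "h w' = h u" "D `` {h u} = {h (h u), w'}" using u(2) by (auto simp: S0_def)
    obtain w where w: "w \<in> X" "h w = u" using pre[OF u(1)] by blast
    have "w' = u" using w'(1,2) u(1) h(1) by simp
    then have "h ` (D `` {u}) = h ` {h u, w}"
      using w'(3) w(2) image_out[OF h(1) u(1)] by simp
    then have "D `` {u} = {h u, w}"
      using inj_on_image_eq_iff[OF inj[OF h(1)] out_subset, of "{h u, w}"] w(1) u(1) h(1) by simp
    then show ?thesis using u(1) w by (auto simp: S0_def)
  qed
  have "S0 = X"
  proof (rule connected_closure[of y1])
    \<comment> \<open>The start is \<open>y1\<close> and not \<open>y0\<close>, because both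
      neighbours of \<open>y1\<close> are known: \<open>y2 = h y1\<close> and
      \<open>y0\<close>.\<close>
    show "y1 \<in> S0" using yX y2 h by (auto simp: S0_def)
    show "y1 \<in> X" "S0 \<subseteq> X" using yX by (auto simp: S0_def)
    fix u v assume u: "u \<in> S0" and "(u, v) \<in> D \<union> D\<inverse>"
    then have uv: "v \<in> D `` {u}" using sym by auto
    obtain w where w: "u \<in> X" "w \<in> X" "h w = u" "D `` {u} = {h u, w}" using u by (auto simp: S0_def)
    have "D `` {h u} = {h (h u), u}" using image_out[OF h(1) w(1)] w(3,4) by simp
    then have "h u \<in> S0" using w(1) h(1) by (auto simp: S0_def)
    moreover have "w \<in> S0" using pred_mem[OF w(2)] w(3) u by simp
    ultimately show "v \<in> S0" using uv w(4) by auto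
  qed
  then have nbr: "\<exists>w\<in>X. h w = u \<and> D `` {u} = {h u, w}" if "u \<in> X" for u
    using that by (auto simp: S0_def)
  have "\<exists>(e :: int \<Rightarrow> _) r. r > 0 \<and> range e = X \<and> e 0 = y0 \<and> (\<forall>i. h (e i) = e (i + 1))
    \<and> (\<forall>i j. e i = e j \<longleftrightarrow> i mod int r = j mod int r)"
  proof (rule ex_cyclic_enumeration[OF h(1) yX(1)])
    fix S assume S: "y0 \<in> S" "S \<subseteq> X" "\<And>u. u \<in> S \<Longrightarrow> h u \<in> S" "\<And>u. u \<in> X \<Longrightarrow> h u \<in> S \<Longrightarrow> u \<in> S"
    show "S = X"
    proof (rule connected_closure[OF S(1) yX(1) S(2)])
      fix u v assume u: "u \<in> S" and "(u, v) \<in> D \<union> D\<inverse>"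
      then have uv: "v \<in> D `` {u}" using sym by auto
      obtain w where "w \<in> X" "h w = u" "D `` {u} = {h u, w}" using nbr u S(2) by blast
      then show "v \<in> S" using uv u S(3)[of u] S(4)[of w] by auto
    qed
  qed
  then obtain e :: "int \<Rightarrow> 'a" and r where e: "r > 0" "range e = X" "\<And>i. h (e i) = e (i + 1)"
    "\<And>i j. e i = e j \<longleftrightarrow> i mod int r = j mod int r" by blast
  have eX: "e i \<in> X" for i using e(2) by blast
  have "cyclic_enumeration X H e r"
    by (intro cyclic_enumeration.intro cyclic_enumeration_axioms.intro permutation_group_axioms e)
  moreover have "D `` {e i} = {e (i + 1), e (i - 1)}" for i
  proof -
    obtain w where w: "w \<in> X" "h w = e i" "D `` {e i} = {h (e i), w}" using nbr[OF eX] by blast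
    have "h (e (i - 1)) = h w" using w(2) e(3)[of "i - 1"] by simp
    then have "e (i - 1) = w" using w(1) eX h(1) by simp
    then show ?thesis using w(3) e(3) by simp
  qed
  ultimately show ?thesis by blast
qed

text \<open>Irreflexivity rules out \<open>r = 1\<close>. The final equivalence singles out the
  cycle of length two, where the next and the previous point coincide; longer cycles are then
  asymmetric by \<open>symmetric_or_asymmetric\<close>.\<close>

lemma valency_one_quotient:
  assumes valency: "\<And>x. x \<in> X \<Longrightarrow> card (D `` {x}) = 1" and irrefl: "\<And>x. (x, x) \<notin> D"
    and \<Gamma>: "pverts \<Gamma> = X" "parcs \<Gamma> = D \<union> D\<inverse>" "pair_wf_digraph \<Gamma>"
  shows "\<exists>r\<ge>2. card X = r \<and> perm_group X H \<cong> integer_mod_group r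
    \<and> digraph_iso (with_proj \<Gamma>) (with_proj (cycle_graph r)) \<and> (r = 2 \<longleftrightarrow> D\<inverse> = D)"
proof -
  obtain e r where "cyclic_enumeration X H e r" and out: "\<And>i. D `` {e i} = {e (i + 1)}"
    using valency_one_cyclic_enumeration[OF valency] by blast
  then interpret cyclic_enumeration X H e r by blast
  have D: "(e i, x) \<in> D \<longleftrightarrow> x = e (i + 1)" for i x using out[of i] by blast
  have "e 0 \<noteq> e 1" using D[of 0 "e 1"] irrefl[of "e 0"] by auto
  then have "r \<noteq> 1" by (auto simp: e_eq)
  then have r: "r \<ge> 2" using r_pos by simp
  have "perm_group X H \<cong> integer_mod_group r"
  proof (rule perm_group_iso_cyclic)
    fix g i j assume "g \<in> H" "g (e i) = e j"
    then show "g (e (i + 1)) = e (j + 1)"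
      using orbital_closed[of g "e i" "e (i + 1)"] by (simp add: D)
  qed (use transitive in simp)
  moreover have "digraph_iso (with_proj \<Gamma>) (with_proj (cycle_graph r))"
    by (rule digraph_iso_cycle_graph[OF \<Gamma>(1,3)]) (simp add: \<Gamma>(2) D)
  moreover have "r = 2 \<longleftrightarrow> D\<inverse> = D"
  proof
    assume r2: "r = 2"
    have "(e i, e j) \<in> D \<longleftrightarrow> (e j, e i) \<in> D" for i j
      unfolding D e_eq r2 by (simp add: mod_eq_dvd_iff) auto
    moreover have "u \<in> X \<and> v \<in> X" if "(u, v) \<in> D" for u v using that orbital_subset by blast
    ultimately have "(v, u) \<in> D" if "(u, v) \<in> D" for u v
      using that by (metis memE)
    then show "D\<inverse> = D" by auto
  next
    assume "D\<inverse> = D"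
    then have "(e 1, e 0) \<in> D" using D[of 0 "e 1"] by auto
    then have "0 mod int r = 2 mod int r" by (simp add: D e_eq)
    then have "int r dvd 2" by (simp add: mod_eq_0_iff_dvd)
    then show "r = 2" using r by (auto dest: zdvd_imp_le)
  qed
  ultimately show ?thesis using r card_domain by blast
qed

text \<open>By symmetry arcs run both ways round the cycle, so \<open>orbital_transitive\<close>
  supplies rotations and reflections alike.\<close>

lemma valency_two_symmetric_quotient:
  assumes sym: "D\<inverse> = D" and valency: "\<And>x. x \<in> X \<Longrightarrow> card (D `` {x}) = 2"
    and \<Gamma>: "pverts \<Gamma> = X" "parcs \<Gamma> = D" "pair_wf_digraph \<Gamma>"
  shows "\<exists>r\<ge>3. perm_group X H \<cong> dihedral_group r
    \<and> digraph_iso (with_proj \<Gamma>) (with_proj (cycle_graph r))"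
proof -
  obtain e r where "cyclic_enumeration X H e r" and out: "\<And>i. D `` {e i} = {e (i + 1), e (i - 1)}"
    using valency_two_cyclic_enumeration[OF sym valency] by blast
  then interpret cyclic_enumeration X H e r by blast
  have D: "(e i, x) \<in> D \<longleftrightarrow> x = e (i + 1) \<or> x = e (i - 1)" for i x using out[of i] by blast
  \<comment> \<open>These two points make up a set of two elements; for \<open>r = 1\<close> or
    \<open>r = 2\<close> they would coincide.\<close>
  have "e 1 \<noteq> e (- 1)" using valency[of "e 0"] out[of 0] by auto
  then have "r \<noteq> 1" "r \<noteq> 2" by (auto simp: e_eq)
  then have r: "r \<ge> 3" using r_pos by simp
  have "perm_group X H \<cong> dihedral_group r"
  proof (rule perm_group_iso_dihedral[OF r])
    fix g i j assume "g \<in> H" "g (e i) = e j"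
    then show "{g (e (i + 1)), g (e (i - 1))} = {e (j + 1), e (j - 1)}"
      using image_out[of g "e i"] by (simp add: out)
  next
    fix c s :: int assume "s = 1 \<or> s = - 1"
    then have "(e 0, e 1) \<in> D" "(e c, e (c + s)) \<in> D" by (auto simp: D)
    then show "\<exists>g\<in>H. g (e 0) = e c \<and> g (e 1) = e (c + s)" by (rule orbital_transitive)
  qed
  moreover have "digraph_iso (with_proj \<Gamma>) (with_proj (cycle_graph r))"
  proof (rule digraph_iso_cycle_graph[OF \<Gamma>(1,3)])
    fix i j
    have "e j = e (i - 1) \<longleftrightarrow> e i = e (j + 1)"
      by (simp add: e_eq mod_eq_dvd_iff) (metis dvd_minus_iff minus_diff_eq diff_diff_eq2 add.commute)
    then show "(e i, e j) \<in> parcs \<Gamma> \<longleftrightarrow> e j = e (i + 1) \<or> e i = e (j + 1)"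
      by (simp add: \<Gamma>(2) D)
  qed
  ultimately show ?thesis using r by blast
qed

end

section \<open>Normal quotients of oriented graphs\<close>

lemma connected_with_proj_iff:
  assumes "pair_graph \<Gamma>"
  shows "connected (with_proj \<Gamma>) \<longleftrightarrow>
    pverts \<Gamma> \<noteq> {} \<and> (\<forall>x\<in>pverts \<Gamma>. \<forall>y\<in>pverts \<Gamma>. (x, y) \<in> (parcs \<Gamma>)\<^sup>*)"
proof -
  interpret pair_graph \<Gamma> by fact
  have sub: "parcs \<Gamma> \<subseteq> pverts \<Gamma> \<times> pverts \<Gamma>" using wellformed' by auto
  have "parcs (mk_symmetric (with_proj \<Gamma>)) = parcs \<Gamma>"
    using adj_mk_symmetric_eq[OF pair_sym_arcs] by simp
  moreover have "(x, y) \<in> rtrancl_on (pverts \<Gamma>) (parcs \<Gamma>) \<longleftrightarrow> (x, y) \<in> (parcs \<Gamma>)\<^sup>*"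
    if x: "x \<in> pverts \<Gamma>" for x y
  proof
    assume "(x, y) \<in> rtrancl_on (pverts \<Gamma>) (parcs \<Gamma>)"
    then show "(x, y) \<in> (parcs \<Gamma>)\<^sup>*"
      by (induction rule: rtrancl_on_induct) (auto intro: rtrancl_into_rtrancl)
  next
    assume "(x, y) \<in> (parcs \<Gamma>)\<^sup>*"
    then show "(x, y) \<in> rtrancl_on (pverts \<Gamma>) (parcs \<Gamma>)"
    proof (induction rule: rtrancl_induct)
      case (step y z)
      then show ?case using sub by (blast intro: rtrancl_on_into_rtrancl_on)
    qed (use x in simp)
  qed
  ultimately show ?thesis
    by (simp add: connected_def strongly_connected_def reachable_def)
qed

lemma irreflexive_Diff_Id: "(\<And>x. (x, x) \<notin> R) \<Longrightarrow> R \<union> R\<inverse> - Id = R \<union> R\<inverse>"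
  by blast

lemma out_degree_with_proj: "out_degree (with_proj \<Gamma>) x = card (parcs \<Gamma> `` {x})"
proof -
  have "out_arcs (with_proj \<Gamma>) x = Pair x ` (parcs \<Gamma> `` {x})"
    by (auto simp: out_arcs_def)
  then show ?thesis by (simp add: out_degree_def card_image inj_on_def)
qed

text \<open>Asymmetry splits the neighbours of a point into out-neighbours and in-neighbours, two
  sets of the same size; hence the factor 2.\<close>

lemma OG_connected_orbital:
  assumes "(\<Gamma>, G) \<in> OG m"
  obtains D where "connected_orbital (pverts \<Gamma>) G D" "D \<inter> D\<inverse> = {}" "parcs \<Gamma> = D \<union> D\<inverse>"
    "\<And>x. x \<in> pverts \<Gamma> \<Longrightarrow> 2 * card (D `` {x}) = m"
proof -
  let ?X = "pverts \<Gamma>"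
  have \<Gamma>: "pair_graph \<Gamma>" "connected (with_proj \<Gamma>)"
    and valency: "\<And>x. x \<in> ?X \<Longrightarrow> card (parcs \<Gamma> `` {x}) = m"
    and G: "subgroup G (BijGroup ?X)" "vertex_transitive \<Gamma> G" "oriented \<Gamma> G"
    using assms by (auto simp: OG_def out_degree_with_proj)
  interpret pair_graph \<Gamma> by (rule \<Gamma>(1))
  interpret permutation_group ?X G by (rule permutation_group.intro[OF G(1)])
  obtain D where orb: "D \<in> orbits (perm_group ?X G) (?X \<times> ?X) (\<lambda>g. map_prod g g)"
    and D: "D \<inter> D\<inverse> = {}" "parcs \<Gamma> = D \<union> D\<inverse>"
    using G(3) unfolding oriented_def by blast
  then obtain x0 y0 where xy: "x0 \<in> ?X" "y0 \<in> ?X"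
    and "D = orbit (perm_group ?X G) (\<lambda>g. map_prod g g) (x0, y0)"
    unfolding orbits_def by blast
  then have D_def: "D = (\<lambda>g. (g x0, g y0)) ` G" by (auto simp: orbit_def)
  have "connected_orbital ?X G D"
  proof (intro connected_orbital.intro transitive_permutation_group.intro
      transitive_permutation_group_axioms.intro connected_orbital_axioms.intro permutation_group_axioms)
    show "finite ?X" by (rule pair_finite_verts)
    show "?X \<noteq> {}" using xy by blast
    show "\<exists>g\<in>G. g x = y" if "x \<in> ?X" "y \<in> ?X" for x y
      using transitive_action.unique_orbit[OF G(2)[unfolded vertex_transitive_def] that] by simp
    show "D \<subseteq> ?X \<times> ?X" using xy by (auto simp: D_def)
    show "D \<noteq> {}" using id_mem by (auto simp: D_def)
    show "(g x, g y) \<in> D" if g: "g \<in> G" and xyD: "(x, y) \<in> D" for g x y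
    proof -
      obtain h where h: "h \<in> G" "x = h x0" "y = h y0" using xyD by (auto simp: D_def)
      then have "(g x, g y) = (compose ?X g h x0, compose ?X g h y0)" using xy by (simp add: compose_eq)
      then show ?thesis using compose_mem[OF g h(1)] unfolding D_def by (rule image_eqI)
    qed
    show "\<exists>g\<in>G. g x = x' \<and> g y = y'" if xyD: "(x, y) \<in> D" "(x', y') \<in> D" for x y x' y'
    proof -
      obtain h where h: "h \<in> G" "x = h x0" "y = h y0" using xyD(1) by (auto simp: D_def)
      obtain h' where h': "h' \<in> G" "x' = h' x0" "y' = h' y0" using xyD(2) by (auto simp: D_def)
      \<comment> \<open>\<open>k\<close> inverts \<open>h\<close>, so \<open>h'\<close> after
        \<open>k\<close> passes through the base pair \<open>(x0, y0)\<close>.\<close>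
      obtain k where "k \<in> G" "\<forall>x\<in>?X. k (h x) = x" using ex_inverse[OF h(1)] by blast
      then show ?thesis using h h' xy compose_mem
        by (intro bexI[of _ "compose ?X h' k"]) (simp_all add: compose_eq)
    qed
    show "(x, y) \<in> (D \<union> D\<inverse>)\<^sup>*" if "x \<in> ?X" "y \<in> ?X" for x y
      using that \<Gamma> D(2) by (simp add: connected_with_proj_iff)
  qed
  then interpret connected_orbital ?X G D .
  have "2 * card (D `` {x}) = m" if x: "x \<in> ?X" for x
  proof -
    interpret C: connected_orbital ?X G "D\<inverse>" by (rule connected_orbital_converse)
    have "m = card (D `` {x} \<union> D\<inverse> `` {x})" using valency[OF x] D(2) by (simp add: Un_Image)
    also have "\<dots> = card (D `` {x}) + card (D\<inverse> `` {x})"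
      using finite_out C.finite_out D(1) by (intro card_Un_disjoint) auto
    finally show ?thesis using card_in_eq_card_out[OF x] by simp
  qed
  then show ?thesis using that connected_orbital_axioms D by blast
qed

section \<open>From orbitals back to properties of graphs\<close>

context connected_orbital
begin

lemma vertex_transitiveI: "pverts \<Gamma> = X \<Longrightarrow> vertex_transitive \<Gamma> H"
  unfolding vertex_transitive_def
  by (intro transitive_action.intro transitive_action_axioms.intro)
    (simp_all add: group_action_apply transitive)

lemma arc_transitiveI:
  assumes "pverts \<Gamma> = X" "parcs \<Gamma> = D" shows "arc_transitive \<Gamma> H"
  unfolding arc_transitive_def assms
proof (intro transitive_action.intro transitive_action_axioms.intro)
  show "group_action (perm_group X H) D (\<lambda>g. restrict (map_prod g g) D)"
    by (rule group_action_pairs[OF orbital_subset]) (rule orbital_closed)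
  fix p q assume pq: "p \<in> D" "q \<in> D"
  obtain x y x' y' where "p = (x, y)" "q = (x', y')" by fastforce
  then show "\<exists>g\<in>carrier (perm_group X H). restrict (map_prod g g) D p = q"
    using pq orbital_transitive[of x y x' y'] by auto
qed

lemma orientedI:
  assumes "D \<inter> D\<inverse> = {}" "pverts \<Gamma> = X" "parcs \<Gamma> = D \<union> D\<inverse>" shows "oriented \<Gamma> H"
proof -
  obtain x y where xy: "(x, y) \<in> D" using orbital_nonempty by auto
  have "D = orbit (perm_group X H) (\<lambda>g. map_prod g g) (x, y)"
    using orbital_closed[OF _ xy] orbital_transitive[OF xy] by (fastforce simp: orbit_def)
  moreover have "(x, y) \<in> X \<times> X" using xy orbital_subset by blast
  ultimately have "D \<in> orbits (perm_group X H) (X \<times> X) (\<lambda>g. map_prod g g)"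
    unfolding orbits_def by blast
  then show ?thesis using assms by (auto simp: oriented_def)
qed

lemma pair_graphI:
  assumes "\<And>x. (x, x) \<notin> D" "pverts \<Gamma> = X" "parcs \<Gamma> = D \<union> D\<inverse>" shows "pair_graph \<Gamma>"
proof
  show "finite (pverts \<Gamma>)" "finite (parcs \<Gamma>)" using finite_domain finite_orbital assms by auto
  show "symmetric (with_proj \<Gamma>)" using assms by (auto simp: symmetric_def intro: symI)
qed (use assms orbital_subset in auto)

lemma asymmetric_imp_OG:
  assumes asym: "D \<inter> D\<inverse> = {}" and \<Gamma>: "pverts \<Gamma> = X" "parcs \<Gamma> = D \<union> D\<inverse>"
    and valency: "\<And>x. x \<in> X \<Longrightarrow> 2 * card (D `` {x}) = m"
  shows "(\<Gamma>, H) \<in> OG m"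
  unfolding OG_def
proof (clarify, intro conjI)
  have closed_arcs: "(g x, g y) \<in> parcs \<Gamma>" if "g \<in> H" "(x, y) \<in> parcs \<Gamma>" for g x y
    using that orbital_closed[OF that(1)] \<Gamma>(2) by auto
  show pg: "pair_graph \<Gamma>" using asym by (intro pair_graphI[OF _ \<Gamma>]) blast
  show "connected (with_proj \<Gamma>)"
    using nonempty orbital_connected \<Gamma> by (simp add: connected_with_proj_iff[OF pg])
  show "\<forall>x\<in>pverts \<Gamma>. out_degree (with_proj \<Gamma>) x = m"
  proof
    fix x assume "x \<in> pverts \<Gamma>"
    then have x: "x \<in> X" using \<Gamma>(1) by simp
    interpret C: connected_orbital X H "D\<inverse>" by (rule connected_orbital_converse)
    have "card (D `` {x} \<union> D\<inverse> `` {x}) = card (D `` {x}) + card (D\<inverse> `` {x})"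
      using finite_out C.finite_out asym by (intro card_Un_disjoint) auto
    then show "out_degree (with_proj \<Gamma>) x = m"
      using card_in_eq_card_out[OF x] valency[OF x]
      by (simp add: out_degree_with_proj \<Gamma>(2) Un_Image)
  qed
  show "subgroup H (BijGroup (pverts \<Gamma>))" using subgroup_BijGroup \<Gamma>(1) by simp
  show "H \<subseteq> graph_Aut \<Gamma>" using in_Bij orbital_iff by (auto simp: graph_Aut_def \<Gamma>)
  show "vertex_transitive \<Gamma> H" by (rule vertex_transitiveI[OF \<Gamma>(1)])
  show "oriented \<Gamma> H" by (rule orientedI[OF asym \<Gamma>])
  \<comment> \<open>Every edge has a representative arc in \<open>D\<close> itself, so edge
    transitivity reduces to transitivity on \<open>D\<close>.\<close>
  have edges_D: "edges \<Gamma> = {{x, y} | x y. (x, y) \<in> D}"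
    unfolding edges_def \<Gamma>(2) by (auto simp: insert_commute)
  show "edge_transitive \<Gamma> H"
    unfolding edge_transitive_def \<Gamma>(1)
  proof (intro transitive_action.intro transitive_action_axioms.intro)
    show "group_action (perm_group X H) (edges \<Gamma>) (set_action (edges \<Gamma>))"
    proof (rule group_action_set_action)
      show "edges \<Gamma> \<subseteq> Pow X" using orbital_subset by (auto simp: edges_D)
      fix g E assume g: "g \<in> H" and "E \<in> edges \<Gamma>"
      then obtain x y where "E = {x, y}" "(x, y) \<in> D" by (auto simp: edges_D)
      then have "g ` E = {g x, g y}" "(g x, g y) \<in> D" using orbital_closed[OF g] by auto
      then show "g ` E \<in> edges \<Gamma>" unfolding edges_D by blast
    qed
    fix E F assume EF: "E \<in> edges \<Gamma>" "F \<in> edges \<Gamma>"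
    obtain x y where xy: "E = {x, y}" "(x, y) \<in> D" using EF(1) by (auto simp: edges_D)
    obtain x' y' where xy': "F = {x', y'}" "(x', y') \<in> D" using EF(2) by (auto simp: edges_D)
    obtain g where "g \<in> H" "g x = x'" "g y = y'" using orbital_transitive[OF xy(2) xy'(2)] by blast
    then show "\<exists>g\<in>carrier (perm_group X H). set_action (edges \<Gamma>) g E = F"
      using xy(1) xy'(1) EF(1) by (intro bexI[of _ g]) (simp_all add: set_action_def)
  qed
qed

end

section \<open>The quotient graph and its multicover numbers\<close>

locale graph_normal_quotient = normal_subgroup_orbits +
  fixes \<Gamma> :: "'a pair_pre_digraph"
  assumes verts: "pverts \<Gamma> = X"
    and arcs: "parcs \<Gamma> = D \<union> D\<inverse>"
    and asym: "D \<inter> D\<inverse> = {}"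
begin

lemma vertex_orbits: "vertex_orbits \<Gamma> N = blocks"
  by (simp add: vertex_orbits_conv verts)

lemma induced_group: "induced_group \<Gamma> H N = induced"
  by (simp add: induced_group_def vertex_orbits)

lemma pverts_quotient: "pverts (normal_quotient \<Gamma> N) = blocks"
  by (simp add: normal_quotient_def vertex_orbits)

text \<open>Arcs of \<open>\<Gamma>\<close> inside a block become loops of
  \<open>quotient_orbital\<close>, which \<open>normal_quotient\<close> discards; hence the removal
  of \<open>Id\<close>.\<close>

lemma parcs_quotient: "parcs (normal_quotient \<Gamma> N) = (quotient_orbital \<union> quotient_orbital\<inverse>) - Id"
proof -
  have D: "(\<exists>x\<in>B. \<exists>y\<in>C. (x, y) \<in> D) \<longleftrightarrow> (B, C) \<in> quotient_orbital" if BC: "B \<in> blocks" "C \<in> blocks" for B C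
  proof
    assume "\<exists>x\<in>B. \<exists>y\<in>C. (x, y) \<in> D"
    then obtain x y where xy: "x \<in> B" "y \<in> C" "(x, y) \<in> D" by blast
    obtain u v where uv: "u \<in> X" "v \<in> X" "B = block u" "C = block v" using BC by blast
    have "block x = B" "block y = C"
      using N.point_orbit_eq[of u x] N.point_orbit_eq[of v y] uv xy by simp_all
    then show "(B, C) \<in> quotient_orbital" using xy(3) by force
  next
    assume "(B, C) \<in> quotient_orbital"
    then obtain x y where xy: "(x, y) \<in> D" "B = block x" "C = block y" by auto
    then have "x \<in> B" "y \<in> C" using orbital_subset N.point_orbit_self by auto
    then show "\<exists>x\<in>B. \<exists>y\<in>C. (x, y) \<in> D" using xy(1) by blast
  qed
  have *: "(\<exists>x\<in>B. \<exists>y\<in>C. (x, y) \<in> parcs \<Gamma>) \<longleftrightarrow> (B, C) \<in> quotient_orbital \<union> quotient_orbital\<inverse>"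
    if "B \<in> blocks" "C \<in> blocks" for B C
  proof -
    have "(\<exists>x\<in>B. \<exists>y\<in>C. (x, y) \<in> parcs \<Gamma>) \<longleftrightarrow>
      (\<exists>x\<in>B. \<exists>y\<in>C. (x, y) \<in> D) \<or> (\<exists>y\<in>C. \<exists>x\<in>B. (y, x) \<in> D)"
      unfolding arcs by blast
    then show ?thesis by (simp only: D[OF that] D[OF that(2,1)] Un_iff converse_iff)
  qed
  have sub: "B \<in> blocks" "C \<in> blocks" if "(B, C) \<in> quotient_orbital \<union> quotient_orbital\<inverse>" for B C
    using that Q.orbital_subset by blast+
  have iff: "(B, C) \<in> parcs (normal_quotient \<Gamma> N) \<longleftrightarrow> (B, C) \<in> (quotient_orbital \<union> quotient_orbital\<inverse>) - Id" for B C
  proof -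
    have "(B, C) \<in> parcs (normal_quotient \<Gamma> N) \<longleftrightarrow>
      B \<in> blocks \<and> C \<in> blocks \<and> B \<noteq> C \<and> (\<exists>x\<in>B. \<exists>y\<in>C. (x, y) \<in> parcs \<Gamma>)"
      by (simp only: normal_quotient_def vertex_orbits pair_pre_digraph.simps mem_Collect_eq prod.case)
    then show ?thesis using *[of B C] sub[of B C] by (metis Diff_iff pair_in_Id_conv)
  qed
  show ?thesis
  proof (rule Set.set_eqI)
    show "p \<in> parcs (normal_quotient \<Gamma> N) \<longleftrightarrow> p \<in> (quotient_orbital \<union> quotient_orbital\<inverse>) - Id" for p
      by (cases p) (simp only: iff)
  qed
qed

lemma parcs_quotient_irreflexive:
  "(\<And>B. (B, B) \<notin> quotient_orbital) \<Longrightarrow>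
    parcs (normal_quotient \<Gamma> N) = quotient_orbital \<union> quotient_orbital\<inverse>"
  unfolding parcs_quotient by (rule irreflexive_Diff_Id)

lemma card_arcs_into:
  assumes "x \<in> X"
  shows "card {y \<in> C. (x, y) \<in> parcs \<Gamma>} = card (D `` {x} \<inter> C) + card (D\<inverse> `` {x} \<inter> C)"
proof -
  interpret C: connected_orbital X H "D\<inverse>" by (rule connected_orbital_converse)
  have "{y \<in> C. (x, y) \<in> parcs \<Gamma>} = (D `` {x} \<inter> C) \<union> (D\<inverse> `` {x} \<inter> C)" by (auto simp: arcs)
  moreover have "finite (D `` {x} \<inter> C)" "finite (D\<inverse> `` {x} \<inter> C)"
    using finite_out C.finite_out by blast+
  moreover have "(D `` {x} \<inter> C) \<inter> (D\<inverse> `` {x} \<inter> C) = {}" using asym by blast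
  ultimately show ?thesis by (simp add: card_Un_disjoint)
qed

text \<open>The factorisation for the converse orbital, with both in-valencies replaced by the equal
  out-valencies.\<close>

lemma card_in_factor:
  assumes "x \<in> X" "(C, block x) \<in> quotient_orbital"
  shows "card (D `` {x}) = card (quotient_orbital `` {block x}) * card (D\<inverse> `` {x} \<inter> C)"
proof -
  interpret C: normal_subgroup_orbits X H "D\<inverse>" N by (rule converse)
  show ?thesis
    using C.card_out_factor[OF assms(1), of C] assms card_in_eq_card_out[OF assms(1)]
      Q.card_in_eq_card_out[of "block x"]
    by (simp add: quotient_orbital_converse)
qed

lemma in_inter_block_empty:
  assumes "x \<in> X" "C \<in> blocks" "(C, block x) \<notin> quotient_orbital"
  shows "D\<inverse> `` {x} \<inter> C = {}"
proof -
  interpret C: normal_subgroup_orbits X H "D\<inverse>" N by (rule converse)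
  show ?thesis
    using C.out_inter_block_empty[OF assms(1,2)] assms(3) by (simp add: quotient_orbital_converse)
qed

lemma normal_multicoverI:
  assumes "\<And>x C. x \<in> X \<Longrightarrow> C \<in> blocks \<Longrightarrow> (block x, C) \<in> quotient_orbital \<union> quotient_orbital\<inverse> \<Longrightarrow>
    card (D `` {x} \<inter> C) + card (D\<inverse> `` {x} \<inter> C) = l"
  shows "normal_multicover l \<Gamma> N"
  unfolding normal_multicover_def
proof (clarify)
  fix B C x assume "(B, C) \<in> parcs (normal_quotient \<Gamma> N)" and x: "x \<in> B"
  then have BC: "(B, C) \<in> quotient_orbital \<union> quotient_orbital\<inverse>" by (simp add: parcs_quotient)
  then have "B \<in> blocks" "C \<in> blocks" using Q.orbital_subset by blast+
  then obtain u where u: "u \<in> X" "B = block u" by blast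
  then have xX: "x \<in> X" "block x = B" 
    using x N.point_orbit_subset[of u] N.point_orbit_eq[of u x] by auto
  show "card {y \<in> C. (x, y) \<in> parcs \<Gamma>} = l"
    using card_arcs_into[OF xX(1)] assms[OF xX(1) \<open>C \<in> blocks\<close>] BC xX(2) by simp
qed

text \<open>All arcs between a point and an adjacent block run in one direction, so one of the two
  summands vanishes; the other follows by cancelling the positive valency of the quotient.\<close>

lemma normal_multicover_asymmetric:
  assumes Q: "quotient_orbital \<inter> quotient_orbital\<inverse> = {}"
    and l: "\<And>x. x \<in> X \<Longrightarrow> card (D `` {x}) = card (quotient_orbital `` {block x}) * l"
  shows "normal_multicover l \<Gamma> N"
proof (rule normal_multicoverI)
  fix x C assume x: "x \<in> X" and C: "C \<in> blocks"
    and xC: "(block x, C) \<in> quotient_orbital \<union> quotient_orbital\<inverse>"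
  have pos: "card (quotient_orbital `` {block x}) > 0"
    using Q.out_nonempty[of "block x"] Q.finite_out x by (simp add: card_gt_0_iff)
  consider "(block x, C) \<in> quotient_orbital" "(C, block x) \<notin> quotient_orbital"
    | "(C, block x) \<in> quotient_orbital" "(block x, C) \<notin> quotient_orbital"
    using xC Q by (metis IntI Un_iff converse_iff empty_iff)
  then show "card (D `` {x} \<inter> C) + card (D\<inverse> `` {x} \<inter> C) = l"
  proof cases
    case 1
    then show ?thesis
      using card_out_factor[OF x 1(1)] l[OF x] pos in_inter_block_empty[OF x C 1(2)] by simp
  next
    case 2
    then show ?thesis
      using card_in_factor[OF x 2(1)] l[OF x] pos out_inter_block_empty[OF x C 2(2)] by simp
  qed
qed

text \<open>Here a point sends arcs into each adjacent block and receives equally many from it,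
  which accounts for the 2 in the hypothesis \<open>l\<close>.\<close>

lemma normal_multicover_symmetric:
  assumes Q: "quotient_orbital\<inverse> = quotient_orbital"
    and l: "\<And>x. x \<in> X \<Longrightarrow> 2 * card (D `` {x}) = card (quotient_orbital `` {block x}) * l"
  shows "normal_multicover l \<Gamma> N"
proof (rule normal_multicoverI)
  fix x C assume x: "x \<in> X" and "(block x, C) \<in> quotient_orbital \<union> quotient_orbital\<inverse>"
  then have xC: "(block x, C) \<in> quotient_orbital" "(C, block x) \<in> quotient_orbital"
    using Q by (metis Un_iff converse_iff)+
  have "card (quotient_orbital `` {block x}) > 0"
    using Q.out_nonempty[of "block x"] Q.finite_out x by (simp add: card_gt_0_iff)
  moreover have "card (quotient_orbital `` {block x}) * (card (D `` {x} \<inter> C) + card (D\<inverse> `` {x} \<inter> C))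
      = card (quotient_orbital `` {block x}) * l"
    using card_out_factor[OF x xC(1)] card_in_factor[OF x xC(2)] l[OF x]
    by (simp only: distrib_left)
  ultimately show "card (D `` {x} \<inter> C) + card (D\<inverse> `` {x} \<inter> C) = l" by simp
qed

lemma singleton_quotient:
  assumes "blocks = {B}"
  shows "K\<^bsub>1\<^esub> (with_proj (normal_quotient \<Gamma> N))" "induced = {\<one>\<^bsub>BijGroup blocks\<^esub>}"
    "vertex_transitive \<Gamma> N"
proof -
  have "parcs (normal_quotient \<Gamma> N) = {}"
    using Q.orbital_subset unfolding parcs_quotient assms by auto
  then show "K\<^bsub>1\<^esub> (with_proj (normal_quotient \<Gamma> N))"
    unfolding complete_digraph_pair_def pverts_quotient assms by auto
  have id: "g = (\<lambda>B\<in>blocks. B)" if g: "g \<in> induced" for g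
  proof (rule Q.eqI[OF g Q.id_mem])
    fix C assume "C \<in> blocks"
    then show "g C = (\<lambda>B\<in>blocks. B) C" using Q.closed[OF g] assms by auto
  qed
  have one: "\<one>\<^bsub>BijGroup blocks\<^esub> = (\<lambda>B\<in>blocks. B)" by (simp add: BijGroup_def)
  show "induced = {\<one>\<^bsub>BijGroup blocks\<^esub>}"
    unfolding one
  proof (intro equalityI subsetI)
    show "g \<in> {\<lambda>B\<in>blocks. B}" if "g \<in> induced" for g 
      using id[OF that] by (simp only: singleton_iff)
    show "g \<in> induced" if "g \<in> {\<lambda>B\<in>blocks. B}" for g
      using that Q.id_mem by (simp only: singleton_iff)
  qed
  show "vertex_transitive \<Gamma> N"
    unfolding vertex_transitive_def verts
  proof (intro transitive_action.intro transitive_action_axioms.intro)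
    show "group_action (perm_group X N) X (\<lambda>g. g)" by (rule N.group_action_apply)
    fix x y assume xy: "x \<in> X" "y \<in> X"
    then have "block x \<in> {B}" "block y \<in> {B}" using assms by blast+
    then have "y \<in> block x" using xy N.point_orbit_eq_iff by auto
    then show "\<exists>g\<in>carrier (perm_group X N). g x = y" by (auto simp: point_orbit_def)
  qed
qed

lemma two_block_quotient:
  assumes card: "card blocks = 2" and irrefl: "\<And>B. (B, B) \<notin> quotient_orbital"
  shows "K\<^bsub>2\<^esub> (with_proj (normal_quotient \<Gamma> N))" "is_bipartition \<Gamma> blocks"
proof -
  obtain U V where UV: "blocks = {U, V}" "U \<noteq> V" using card by (auto simp: card_2_iff)
  have sub: "quotient_orbital \<subseteq> {(U, V), (V, U)}"
  proof (rule subrelI)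
    fix B C assume BC: "(B, C) \<in> quotient_orbital"
    then have "(B, C) \<in> {U, V} \<times> {U, V}" using Q.orbital_subset unfolding UV(1) by (rule subsetD[rotated])
    moreover have "B \<noteq> C" using BC irrefl by metis
    ultimately show "(B, C) \<in> {(U, V), (V, U)}" by auto
  qed
  have "R \<union> R\<inverse> = {(U, V), (V, U)}" if "R \<subseteq> {(U, V), (V, U)}" "R \<noteq> {}" for R
    using that by auto
  then have "quotient_orbital \<union> quotient_orbital\<inverse> = {(U, V), (V, U)}"
    using sub Q.orbital_nonempty .
  then have "parcs (normal_quotient \<Gamma> N) = {(U, V), (V, U)}"
    using parcs_quotient_irreflexive[OF irrefl] by simp
  then show "K\<^bsub>2\<^esub> (with_proj (normal_quotient \<Gamma> N))"
    unfolding complete_digraph_pair_def pverts_quotient UV(1) using UV(2) by auto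
  show "is_bipartition \<Gamma> blocks"
    unfolding is_bipartition_def
  proof (intro exI conjI)
    show "blocks = {U, V}" by (rule UV(1))
    show "U \<inter> V = {}" using blocks_disjoint[of U V] UV by simp
    have "\<Union> blocks = X" using N.point_orbit_self N.point_orbit_subset by blast
    then show "U \<union> V = pverts \<Gamma>" by (simp add: UV(1) verts)
    have *: "(x, y) \<in> U \<times> V \<union> V \<times> U" if "(x, y) \<in> D" for x y
    proof -
      have "map_prod block block (x, y) \<in> quotient_orbital" using that by (rule imageI)
      then have "(block x, block y) \<in> {(U, V), (V, U)}" using subsetD[OF sub] by (simp only: map_prod_simp)
      moreover have "x \<in> block x" "y \<in> block y" using that orbital_subset N.point_orbit_self by auto
      ultimately show ?thesis by auto
    qed
    show "parcs \<Gamma> \<subseteq> U \<times> V \<union> V \<times> U" using * by (auto simp: arcs)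
  qed
qed

text \<open>Both claims rest on elements that fix every block: with equal valencies these lie in
  \<open>N\<close>, and a fixed point makes them trivial.\<close>

lemma same_valency_quotient:
  assumes valency: "\<And>x. x \<in> X \<Longrightarrow> card (quotient_orbital `` {block x}) = card (D `` {x})"
  shows "semiregular X N" "kernel (perm_group X H) (BijGroup blocks) (set_action blocks) = N"
proof -
  show "semiregular X N"
    unfolding semiregular_def
  proof (intro ballI impI)
    fix g assume g: "g \<in> N" and "\<exists>x\<in>X. g x = x"
    then obtain x where x: "x \<in> X" "g x = x" by blast
    have "g = (\<lambda>x\<in>X. x)"
    proof (rule fixes_blocks_and_point_imp_id)
      show "g \<in> H" using g N_subset by blast
      show "card (quotient_orbital `` {block y}) = card (D `` {y})" if "y \<in> X" for y
        by (rule valency[OF that])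
      show "block (g y) = block y" if "y \<in> X" for y by (rule block_fixed[OF g that])
    qed (rule x)+
    then show "g = \<one>\<^bsub>BijGroup X\<^esub>" by (simp add: BijGroup_def)
  qed
  have fixes_iff: "set_action blocks g = \<one>\<^bsub>BijGroup blocks\<^esub> \<longleftrightarrow> (\<forall>x\<in>X. block (g x) = block x)"
    if g: "g \<in> H" for g
  proof
    assume "set_action blocks g = \<one>\<^bsub>BijGroup blocks\<^esub>"
    then have "set_action blocks g (block x) = block x" if "x \<in> X" for x
      using that by (simp add: BijGroup_def)
    then show "\<forall>x\<in>X. block (g x) = block x" using g by simp
  next
    assume "\<forall>x\<in>X. block (g x) = block x"
    then have "set_action blocks g = (\<lambda>B\<in>blocks. B)"
      using g by (intro Q.eqI[OF _ Q.id_mem]) auto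
    then show "set_action blocks g = \<one>\<^bsub>BijGroup blocks\<^esub>" by (simp add: BijGroup_def)
  qed
  have "g \<in> N \<longleftrightarrow> (\<forall>x\<in>X. block (g x) = block x)" if "g \<in> H" for g
  proof
    assume fixed: "\<forall>x\<in>X. block (g x) = block x"
    show "g \<in> N"
    proof (rule fixes_blocks_imp_mem)
      show "card (quotient_orbital `` {block y}) = card (D `` {y})" if "y \<in> X" for y
        by (rule valency[OF that])
      show "block (g y) = block y" if "y \<in> X" for y using fixed that by blast
    qed (rule that)
  qed (use block_fixed in blast)
  then show "kernel (perm_group X H) (BijGroup blocks) (set_action blocks) = N"
    using fixes_iff N_subset by (auto simp: kernel_def)
qed

end

section \<open>Case distinction on the quotient orbital\<close>

theorem theorem1p1:
  fixes \<Gamma> :: "'a pair_pre_digraph" and G N :: "('a \<Rightarrow> 'a) set"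
  assumes "(\<Gamma>, G) \<in> OG 4"
    and "N \<lhd> perm_group (pverts \<Gamma>) G"
  shows "group_action (perm_group (pverts \<Gamma>) G) (vertex_orbits \<Gamma> N) (set_action (vertex_orbits \<Gamma> N))
    \<and> subgroup (induced_group \<Gamma> G N) (BijGroup (vertex_orbits \<Gamma> N))
    \<and> (((normal_quotient \<Gamma> N, induced_group \<Gamma> G N) \<in> OG 4
          \<and> normal_cover \<Gamma> N
          \<and> semiregular (pverts \<Gamma>) N
          \<and> kernel (perm_group (pverts \<Gamma>) G) (BijGroup (vertex_orbits \<Gamma> N))
              (set_action (vertex_orbits \<Gamma> N)) = N)
      \<or> ((K\<^bsub>1\<^esub> (with_proj (normal_quotient \<Gamma> N))
            \<and> induced_group \<Gamma> G N = {\<one>\<^bsub>BijGroup (vertex_orbits \<Gamma> N)\<^esub>}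
            \<and> vertex_transitive \<Gamma> N)
        \<or> (K\<^bsub>2\<^esub> (with_proj (normal_quotient \<Gamma> N))
            \<and> perm_group (vertex_orbits \<Gamma> N) (induced_group \<Gamma> G N) \<cong> integer_mod_group 2
            \<and> bipartite \<Gamma>
            \<and> is_bipartition \<Gamma> (vertex_orbits \<Gamma> N))
        \<or> (\<exists>r\<ge>3. digraph_iso (with_proj (normal_quotient \<Gamma> N)) (with_proj (cycle_graph r))
            \<and> perm_group (vertex_orbits \<Gamma> N) (induced_group \<Gamma> G N) \<cong> dihedral_group r
            \<and> arc_transitive (normal_quotient \<Gamma> N) (induced_group \<Gamma> G N)
            \<and> normal_multicover 2 \<Gamma> N)
        \<or> (\<exists>r\<ge>3. digraph_iso (with_proj (normal_quotient \<Gamma> N)) (with_proj (cycle_graph r))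
            \<and> perm_group (vertex_orbits \<Gamma> N) (induced_group \<Gamma> G N) \<cong> integer_mod_group r
            \<and> oriented (normal_quotient \<Gamma> N) (induced_group \<Gamma> G N)
            \<and> normal_multicover 2 \<Gamma> N)))"
proof -
  obtain D where D: "connected_orbital (pverts \<Gamma>) G D" "D \<inter> D\<inverse> = {}" "parcs \<Gamma> = D \<union> D\<inverse>"
    and D4: "\<And>x. x \<in> pverts \<Gamma> \<Longrightarrow> 2 * card (D `` {x}) = 4"
    using OG_connected_orbital[OF assms(1)] by metis
  interpret connected_orbital "pverts \<Gamma>" G D by (rule D(1))
  interpret graph_normal_quotient "pverts \<Gamma>" G D N \<Gamma>
    by (intro graph_normal_quotient.intro graph_normal_quotient_axioms.intro
        normal_subgroup_orbits.intro normal_subgroup_orbits_axioms.intro assms(2) D refl)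
  let ?X = "pverts \<Gamma>" and ?\<Gamma>N = "normal_quotient \<Gamma> N" and ?DN = "quotient_orbital"
  note quotient_simps = vertex_orbits induced_group
  have D2: "card (D `` {x}) = 2" if "x \<in> ?X" for x using D4[OF that] by simp
  have action: "group_action (perm_group ?X G) (vertex_orbits \<Gamma> N) (set_action (vertex_orbits \<Gamma> N))"
    "subgroup (induced_group \<Gamma> G N) (BijGroup (vertex_orbits \<Gamma> N))"
    using group_action_blocks Q.subgroup_BijGroup by (simp_all add: quotient_simps)
  consider (trivial) B where "blocks = {B}" | (irreflexive) "\<And>B. (B, B) \<notin> ?DN"
    using Q.irreflexive_or_singleton by metis
  then show ?thesis
  proof cases
    case trivial
    then show ?thesis using action singleton_quotient by (simp only: quotient_simps) blast
  next
    case irreflexive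
    note arcsN = parcs_quotient_irreflexive[OF irreflexive]
    have wf: "pair_wf_digraph ?\<Gamma>N"
      using Q.pair_graphI[OF irreflexive pverts_quotient arcsN] pair_graph.axioms(1)
        pair_digraph.axioms(1) pair_fin_digraph.axioms(1) by blast
    obtain x0 where x0: "x0 \<in> ?X" using nonempty by blast
    define a where "a = card (?DN `` {block x0})"
    have a: "card (?DN `` {B}) = a" if "B \<in> blocks" for B
      unfolding a_def using Q.card_out_eq[OF that] x0 by blast
    have "?DN `` {block x0} \<noteq> {}" by (rule Q.out_nonempty) (use x0 in simp)
    then obtain C0 where "(block x0, C0) \<in> ?DN" by (metis Image_singleton_iff equals0I)
    then have "a dvd 2" using card_out_factor[OF x0] D2[OF x0] unfolding a_def by (metis dvd_triv_left)
    then have "a = 1 \<or> a = 2" using dvd_imp_le[of a 2] by (cases "a = 0") auto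
    then consider (one) "a = 1" | (sym) "a = 2" "?DN\<inverse> = ?DN" | (asym) "a = 2" "?DN \<inter> ?DN\<inverse> = {}"
      using Q.symmetric_or_asymmetric by metis
    then show ?thesis
    proof cases
      case one
      obtain r where r: "r \<ge> 2" "card blocks = r" "perm_group blocks induced \<cong> integer_mod_group r"
        "digraph_iso (with_proj ?\<Gamma>N) (with_proj (cycle_graph r))" "r = 2 \<longleftrightarrow> ?DN\<inverse> = ?DN"
        using Q.valency_one_quotient[OF _ irreflexive pverts_quotient arcsN wf] a one by auto
      show ?thesis
      proof (cases "r = 2")
        case True
        have "bipartite \<Gamma>" "is_bipartition \<Gamma> blocks" "K\<^bsub>2\<^esub> (with_proj ?\<Gamma>N)"
          using two_block_quotient[OF _ irreflexive] r(2) True by (auto simp: bipartite_def)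
        then show ?thesis using action r(3) True by (simp only: quotient_simps) blast
      next
        case False
        then have asym: "?DN \<inter> ?DN\<inverse> = {}" using r(5) Q.symmetric_or_asymmetric by metis
        have "oriented ?\<Gamma>N induced" by (rule Q.orientedI[OF asym pverts_quotient arcsN])
        moreover have "normal_multicover 2 \<Gamma> N"
          \<comment> \<open>Only one block lies ahead, so it takes both out-neighbours:
            \<open>2 = 1 * 2\<close>.\<close>
          by (rule normal_multicover_asymmetric[OF asym]) (simp add: a one D2)
        moreover have "r \<ge> 3" using r(1) False by simp
        ultimately show ?thesis using action r(3,4) by (simp only: quotient_simps) blast
      qed
    next
      case sym
      then have arcsN': "parcs ?\<Gamma>N = ?DN" using arcsN by simp
      obtain r where "r \<ge> 3" "perm_group blocks induced \<cong> dihedral_group r"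
        "digraph_iso (with_proj ?\<Gamma>N) (with_proj (cycle_graph r))"
        using Q.valency_two_symmetric_quotient[OF sym(2) _ pverts_quotient arcsN' wf] a sym(1) by auto
      moreover have "arc_transitive ?\<Gamma>N induced"
        by (rule Q.arc_transitiveI[OF pverts_quotient arcsN'])
      moreover have "normal_multicover 2 \<Gamma> N"
        \<comment> \<open>The four neighbours of a point are shared by two adjacent blocks.\<close>
        by (rule normal_multicover_symmetric[OF sym(2)]) (simp add: a sym(1) D2)
      ultimately show ?thesis using action by (simp only: quotient_simps) blast
    next
      case asym
      have "(?\<Gamma>N, induced) \<in> OG 4"
        by (rule Q.asymmetric_imp_OG[OF asym(2) pverts_quotient arcsN]) (simp add: a asym(1))
      moreover have "normal_multicover 1 \<Gamma> N"
        \<comment> \<open>Two out-neighbours lie in two different blocks: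
          \<open>2 = 2 * 1\<close>.\<close>
        by (rule normal_multicover_asymmetric[OF asym(2)]) (simp add: a asym(1) D2)
      moreover have "card (?DN `` {block x}) = card (D `` {x})" if "x \<in> ?X" for x
        using that a asym(1) D2 by simp
      ultimately show ?thesis using action same_valency_quotient by (simp only: quotient_simps) blast
    qed
  qed
qed

end
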